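(* Let $\alpha,\beta\in\mathbb{C}$ and let $\varphi\in\mathcal{S}$. If $$|\alpha|\le \frac{1}{2(2+|\beta|)},$$ then $C_{\alpha\beta}[\varphi]\in\mathcal{S}$.
   Context: $\mathbb{D}=\{z\in\mathbb{C}:|z|<1\}$. $\mathcal{A}$ is the class of analytic functions $\varphi$ in $\mathbb{D}$ with $\varphi(0)=0$ and $\varphi'(0)=1$; $\mathcal{S}$ is the subclass of those that are univalent (injective) in $\mathbb{D}$. For $\alpha,\beta\in\mathbb{C}$, $$C_{\alpha\beta}[\varphi](z)=\int_0^z\Big(\frac{\varphi(\zeta)}{\zeta(1-\zeta)^{\beta}}\Big)^{\alpha}\,d\zeta,\qquad z\in\mathbb{D},$$ where the powers are the analytic branches in $\mathbb{D}$ for which the integrand equals $1$ at $\zeta=0$; i.e. the integrand is $(\varphi(\zeta)/\zeta)^{\alpha}(1-\zeta)^{-\alpha\beta}$. *)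

theory Defs
  imports "HOL-Complex_Analysis.Complex_Analysis"
begin

abbreviation unit_disc :: "complex set" where
  "unit_disc \<equiv> ball 0 1"

definition class_A :: "(complex \<Rightarrow> complex) set" where
  "class_A = {\<phi>. \<phi> holomorphic_on unit_disc \<and> \<phi> 0 = 0 \<and> deriv \<phi> 0 = 1}"

definition class_S :: "(complex \<Rightarrow> complex) set" where
  "class_S = {\<phi> \<in> class_A. inj_on \<phi> unit_disc}"

(* The branch of log (\<phi> z / z) on the disc that vanishes at 0, i.e. takes there the logarithm
   of the removable value \<phi>'(0) = 1. The multiplied form exp (L z) * z = \<phi> z avoids the
   division by 0 at the origin. *)
definition is_log_ratio :: "(complex \<Rightarrow> complex) \<Rightarrow> (complex \<Rightarrow> complex) \<Rightarrow> bool" where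
  "is_log_ratio \<phi> L \<longleftrightarrow>
     L holomorphic_on unit_disc \<and> L 0 = 0 \<and> (\<forall>z\<in>unit_disc. exp (L z) * z = \<phi> z)"

(* For \<phi> in class_S such a branch exists and its values on the disc are unique; see the two
   lemmas below. *)
definition log_ratio :: "(complex \<Rightarrow> complex) \<Rightarrow> complex \<Rightarrow> complex" where
  "log_ratio \<phi> = (SOME L. is_log_ratio \<phi> L)"

(* The second factor uses the principal power: 1 - \<zeta> lies in the right half-plane for \<zeta> in the
   disc, so this is the analytic branch equal to 1 at \<zeta> = 0. *)
definition C_integrand ::
    "complex \<Rightarrow> complex \<Rightarrow> (complex \<Rightarrow> complex) \<Rightarrow> complex \<Rightarrow> complex" where
  "C_integrand \<alpha> \<beta> \<phi> \<zeta> = exp (\<alpha> * log_ratio \<phi> \<zeta>) * (1 - \<zeta>) powr (- (\<alpha> * \<beta>))"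

definition C_transform ::
    "complex \<Rightarrow> complex \<Rightarrow> (complex \<Rightarrow> complex) \<Rightarrow> complex \<Rightarrow> complex" where
  "C_transform \<alpha> \<beta> \<phi> z = contour_integral (linepath 0 z) (C_integrand \<alpha> \<beta> \<phi>)"

lemma is_log_ratio_exists:
  assumes "\<phi> \<in> class_S"
  shows "\<exists>L. is_log_ratio \<phi> L"
proof -
  define g where "g z = (if z = 0 then deriv \<phi> 0 else (\<phi> z - \<phi> 0) / (z - 0))" for z
  have \<phi>: "\<phi> holomorphic_on unit_disc" "\<phi> 0 = 0" "deriv \<phi> 0 = 1" "inj_on \<phi> unit_disc"
    using assms by (auto simp: class_S_def class_A_def)
  have g_holo: "g holomorphic_on unit_disc"
    unfolding g_def by (rule pole_lemma_open) (use \<phi> in auto)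
  have g0: "g 0 = 1"
    using \<phi> by (simp add: g_def)
  have g_nz: "g z \<noteq> 0" if "z \<in> unit_disc" for z
    using that \<phi> inj_onD[OF \<phi>(4), of z 0] by (auto simp: g_def)
  obtain h where h: "h holomorphic_on unit_disc" "\<And>z. z \<in> unit_disc \<Longrightarrow> g z = exp (h z)"
    using contractible_imp_holomorphic_log[OF g_holo _ g_nz]
      convex_imp_contractible[OF convex_ball] by metis
  have "exp (h 0) = 1"
    using h(2)[of 0] g0 by simp
  have "is_log_ratio \<phi> (\<lambda>z. h z - h 0)"
    unfolding is_log_ratio_def
  proof (intro conjI ballI)
    show "(\<lambda>z. h z - h 0) holomorphic_on unit_disc"
      by (intro holomorphic_intros h)
    fix z :: complex
    assume z: "z \<in> unit_disc"
    have "exp (h z - h 0) = g z"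
      using h(2)[OF z] \<open>exp (h 0) = 1\<close> by (simp add: exp_diff)
    then show "exp (h z - h 0) * z = \<phi> z"
      using \<phi>(2) by (simp add: g_def split: if_splits)
  qed simp
  then show ?thesis
    by blast
qed

lemma is_log_ratio_unique:
  assumes "is_log_ratio \<phi> L" "is_log_ratio \<phi> M" "z \<in> unit_disc"
  shows "L z = M z"
proof -
  have holo: "L holomorphic_on unit_disc" "M holomorphic_on unit_disc"
    and z0: "L 0 = 0" "M 0 = 0"
    and e: "\<And>w. w \<in> unit_disc \<Longrightarrow> exp (L w) * w = exp (M w) * w"
    using assms(1,2) by (auto simp: is_log_ratio_def)
  define N where "N w = L w - M w" for w
  have N_holo: "N holomorphic_on unit_disc"
    unfolding N_def by (intro holomorphic_intros holo)
  have expN: "exp (N w) = 1" if "w \<in> unit_disc" for w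
    using e[OF that] z0 by (cases "w = 0") (auto simp: N_def exp_diff)
  have "(N has_field_derivative 0) (at w)" if w: "w \<in> unit_disc" for w
  proof -
    obtain D where D: "(N has_field_derivative D) (at w)"
      using holomorphic_on_imp_differentiable_at[OF N_holo open_ball w]
      by (auto simp: field_differentiable_def)
    have "((\<lambda>w. exp (N w)) has_field_derivative exp (N w) * D) (at w)"
      by (rule DERIV_chain2[OF DERIV_exp D])
    moreover have "((\<lambda>w. exp (N w)) has_field_derivative 0) (at w)"
      by (rule has_field_derivative_transform_within_open[OF _ open_ball w, of "\<lambda>_. 1"])
         (auto simp: expN)
    ultimately have "exp (N w) * D = 0"
      by (rule DERIV_unique)
    with D show ?thesis
      by simp
  qed
  then have "\<exists>c. \<forall>w\<in>unit_disc. N w = c"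
    by (intro has_field_derivative_zero_constant)
       (auto intro: has_field_derivative_at_within)
  then have "N z = N 0"
    using assms(3) by auto
  then show ?thesis
    by (simp add: N_def z0)
qed

end

theory Submission
  imports Defs "HOL-Real_Asymp.Real_Asymp"
begin

text \<open>Let f be the transform of \<phi> and let L be the logarithm of \<phi>(z)/z. Then f' = exp (\<alpha> L) (1 - z)^(-\<alpha>\<beta>)
has no zeros and f''/f' = \<alpha> (L' + \<beta> / (1 - z)). By Becker's criterion f is univalent if
(1 - \<bar>z\<bar>^2) \<bar>z f''/f'\<bar> \<le> 1 on the disc. With r = \<bar>z\<bar>, the term with \<beta> contributes at most
\<bar>\<alpha>\<bar> (1 - r^2) r \<bar>\<beta>\<bar> / (1 - r) \<le> 2 \<bar>\<alpha>\<bar> \<bar>\<beta>\<bar>, and the other one at most 4 \<bar>\<alpha>\<bar>, because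
(1 - r^2) \<bar>z L'\<bar> \<le> 4 for univalent \<phi>. The sum 2 \<bar>\<alpha>\<bar> (2 + \<bar>\<beta>\<bar>) is at most 1 by hypothesis.

Becker's criterion (becker_criterion) is proved by the explicit extension of f across the circle due to
Ahlfors and Becker: the condition makes the extension locally injective, and a proper locally injective
self-map of the plane which is injective near infinity is injective (inj_of_locally_inj_proper).

The bound on L' (log_ratio_derivative_bound) rests on Bieberbach's inequality \<bar>a_2\<bar> \<le> 2 for the second
coefficient, used twice: for a Moebius transform H of \<phi>, and for the function u \<mapsto> 1 / (H(z) - H(ru))
built from a value which H omits on a smaller disc (univalent_difference_lower_bound). Bieberbach's inequality comes
from an area estimate in logarithmic coordinates (prawitz_area_estimate), in which powers of \<phi> with
real exponents -q are available. Exponents q < 1/2 are used because the behaviour at infinity is then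
negligible; q \<rightarrow> 1/2 gives the sharp constant.\<close>

section \<open>Becker's univalence criterion\<close>

text \<open>Let E be the set of values taken at least twice. Invariance of domain makes E open, because two
distinct preimages have disjoint neighbourhoods with open images. It is also closed: preimages of a
convergent sequence in E stay bounded, so they have limit points, and the uniform constant \<delta> keeps
the two limits apart. Injectivity near infinity provides a value outside E, so the connected space
forces E to be empty.\<close>
lemma inj_of_locally_inj_proper:
  fixes F :: "'a::euclidean_space \<Rightarrow> 'a"
  assumes cont: "continuous_on UNIV F" and \<delta>: "0 < \<delta>"
    and loc: "\<And>x y. x \<noteq> y \<Longrightarrow> dist x y < \<delta> \<Longrightarrow> F x \<noteq> F y"
    and proper: "\<And>B. bounded B \<Longrightarrow> bounded (F -` B)"
    and far: "\<And>x y. R \<le> norm x \<Longrightarrow> R \<le> norm y \<Longrightarrow> F x = F y \<Longrightarrow> x = y"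
  shows "inj F"
proof -
  define E where "E = {b. \<exists>x y. x \<noteq> y \<and> F x = b \<and> F y = b}"
  have open_img: "open (F ` S)" if "open S" "S \<subseteq> ball x (\<delta>/2)" for S x
  proof (rule invariance_of_domain)
    show "inj_on F S"
    proof (rule inj_onI, rule ccontr)
      fix u v assume uv: "u \<in> S" "v \<in> S" "F u = F v" "u \<noteq> v"
      then have "dist u v < \<delta>"
        using that(2) dist_triangle_half_r[of x u \<delta> v] by (auto simp: subset_iff)
      then show False using loc uv by blast
    qed
  qed (use that continuous_on_subset[OF cont subset_UNIV] in auto)
  have "open E"
  proof (rule openI)
    fix a assume "a \<in> E"
    then obtain x y where xy: "x \<noteq> y" "F x = a" "F y = a" by (auto simp: E_def)
    define \<epsilon> where "\<epsilon> = min (\<delta>/2) (dist x y / 2)"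
    have \<epsilon>: "0 < \<epsilon>" "ball x \<epsilon> \<subseteq> ball x (\<delta>/2)" "ball y \<epsilon> \<subseteq> ball y (\<delta>/2)"
      using \<delta> xy by (auto simp: \<epsilon>_def)
    have disj: "ball x \<epsilon> \<inter> ball y \<epsilon> = {}"
      by (rule disjoint_ballI) (simp add: \<epsilon>_def)
    have "open (F ` ball x \<epsilon> \<inter> F ` ball y \<epsilon>)"
      using open_img[OF open_ball \<epsilon>(2)] open_img[OF open_ball \<epsilon>(3)] by (rule open_Int)
    moreover have "a \<in> F ` ball x \<epsilon> \<inter> F ` ball y \<epsilon>"
      using xy \<epsilon>(1) by (metis IntI centre_in_ball imageI)
    moreover have "F ` ball x \<epsilon> \<inter> F ` ball y \<epsilon> \<subseteq> E"
    proof
      fix b assume "b \<in> F ` ball x \<epsilon> \<inter> F ` ball y \<epsilon>"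
      then obtain u v where uv: "u \<in> ball x \<epsilon>" "v \<in> ball y \<epsilon>" "b = F u" "b = F v" by blast
      then have "u \<noteq> v" using disj by blast
      then show "b \<in> E" unfolding E_def mem_Collect_eq
        by (intro exI[of _ u] exI[of _ v]) (simp add: uv(3)[symmetric] uv(4)[symmetric])
    qed
    ultimately show "\<exists>e>0. ball a e \<subseteq> E"
      by (meson open_contains_ball subset_trans)
  qed
  moreover have "closed E"
  proof (unfold closed_sequential_limits, intro allI impI)
    fix a l assume a: "(\<forall>n. a n \<in> E) \<and> a \<longlonglongrightarrow> l"
    then have "\<forall>n. \<exists>x y. x \<noteq> y \<and> F x = a n \<and> F y = a n" by (simp add: E_def)
    then obtain x y where xy: "\<And>n. x n \<noteq> y n" "\<And>n. F (x n) = a n" "\<And>n. F (y n) = a n" by metis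
    have "bounded (range a)" using a convergent_imp_bounded by blast
    from proper[OF this] have "compact (closure (F -` range a))" by (simp add: compact_closure)
    then have comp: "compact (closure (F -` range a) \<times> closure (F -` range a))" by (intro compact_Times)
    have mem: "\<forall>n. (x n, y n) \<in> closure (F -` range a) \<times> closure (F -` range a)"
      using xy by (auto intro!: subsetD[OF closure_subset])
    obtain p r where r: "strict_mono r" "((\<lambda>n. (x n, y n)) \<circ> r) \<longlonglongrightarrow> p"
      by (rule seq_compactE[OF compact_imp_seq_compact[OF comp] mem]) (rule that; assumption)
    obtain u v where p: "p = (u, v)" by (cases p)
    have xu: "(\<lambda>n. x (r n)) \<longlonglongrightarrow> u" and yv: "(\<lambda>n. y (r n)) \<longlonglongrightarrow> v"
      using tendsto_fst[OF r(2)] tendsto_snd[OF r(2)] by (simp_all add: o_def p)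
    have al: "(\<lambda>n. a (r n)) \<longlonglongrightarrow> l" using a r(1) LIMSEQ_subseq_LIMSEQ by (auto simp: o_def)
    have "isCont F w" for w using cont by (simp add: continuous_on_eq_continuous_at)
    then have "(\<lambda>n. F (x (r n))) \<longlonglongrightarrow> F u" "(\<lambda>n. F (y (r n))) \<longlonglongrightarrow> F v"
      using xu yv isCont_tendsto_compose by blast+
    then have l: "F u = l" "F v = l" using al LIMSEQ_unique by (auto simp: xy)
    have "(\<lambda>n. dist (x (r n)) (y (r n))) \<longlonglongrightarrow> dist u v"
      using xu yv by (rule tendsto_dist)
    moreover have "\<delta> \<le> dist (x (r n)) (y (r n))" for n
    proof (rule ccontr)
      assume "\<not> \<delta> \<le> dist (x (r n)) (y (r n))"
      then have "F (x (r n)) \<noteq> F (y (r n))" using loc[OF xy(1)[of "r n"]] by simp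
      then show False by (simp add: xy(2,3))
    qed
    ultimately have "\<delta> \<le> dist u v" by (meson LIMSEQ_le_const)
    then have "u \<noteq> v" using \<delta> by auto
    then show "l \<in> E" using l by (auto simp: E_def)
  qed
  ultimately have "E = {} \<or> E = UNIV" using clopen by blast
  moreover have "E \<noteq> UNIV"
  proof
    assume "E = UNIV"
    have "compact (F ` cball 0 R)"
      using cont continuous_on_subset by (intro compact_continuous_image) auto
    then have "bounded (F ` cball 0 R)" by (rule compact_imp_bounded)
    then obtain b where b: "\<And>w. w \<in> cball 0 R \<Longrightarrow> norm (F w) \<le> b"
      unfolding bounded_iff by (metis imageI)
    \<comment> \<open>a value too large to be taken on the ball of radius R; all of its preimages are far out\<close>
    obtain a :: 'a where a: "norm a = \<bar>b\<bar> + 1" 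
      using vector_choose_size[of "\<bar>b\<bar> + 1"] by auto
    have "a \<in> E" using \<open>E = UNIV\<close> by simp
    then obtain x y where xy: "x \<noteq> y" "F x = a" "F y = a" unfolding E_def by blast
    have "R \<le> norm w" if "F w = a" for w
      using b[of w] that a by (cases "R \<le> norm w") auto
    then show False using far xy by metis
  qed
  ultimately have "E = {}" by blast
  show "inj F"
  proof (rule injI, rule ccontr)
    fix x y assume "F x = F y" "x \<noteq> y"
    then have "F x \<in> E" unfolding E_def mem_Collect_eq by metis
    then show False using \<open>E = {}\<close> by simp
  qed
qed

text \<open>Inversion folds the exterior of the unit disc onto the disc. Composing a function on the disc with
this folding map extends it continuously to the plane.\<close>
definition circle_reflection :: "complex \<Rightarrow> complex" where
  "circle_reflection z = (if norm z \<le> 1 then z else 1 / cnj z)"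

lemma circle_reflection_in [simp]: "norm (circle_reflection z) \<le> 1"
  by (auto simp: circle_reflection_def norm_divide divide_simps)

text \<open>Inversion multiplies distances by the product of the two image norms. Together with the
exact value of \<bar>z - w\<bar> \<bar>w\<bar> for the reflection w of z, given below, this is what produces the weight
1 - \<bar>w\<bar>^2 of Becker's condition.\<close>
lemma dist_circle_reflection_outside:
  assumes "1 < norm z" "1 < norm y"
  shows "norm (circle_reflection z - circle_reflection y) = 
    norm (circle_reflection z) * norm (circle_reflection y) * norm (z - y)"
proof -
  have nz: "z \<noteq> 0" "y \<noteq> 0" using assms by auto
  then have "circle_reflection z - circle_reflection y = circle_reflection z * circle_reflection y * cnj (y - z)"
    using assms by (simp add: circle_reflection_def field_simps)
  then show ?thesis by (simp add: norm_mult norm_minus_commute flip: complex_cnj_diff)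
qed

lemma norm_sub_circle_reflection:
  assumes "1 < norm z"
  shows "norm (z - circle_reflection z) * norm (circle_reflection z) = 1 - (norm (circle_reflection z))\<^sup>2"
proof -
  have nz: "z \<noteq> 0" using assms by auto
  have e: "z - circle_reflection z = of_real (1 - (norm (circle_reflection z))\<^sup>2) * z"
    using assms nz by (simp add: circle_reflection_def norm_divide power_divide field_simps)
      (simp add: complex_norm_square[symmetric])
  have "(norm (circle_reflection z))\<^sup>2 \<le> 1" by (simp add: abs_square_le_1)
  moreover have "norm z * norm (circle_reflection z) = 1"
    using assms nz by (simp add: circle_reflection_def norm_divide)
  ultimately show ?thesis
    unfolding e norm_mult norm_of_real by (simp add: mult.assoc)
qed

text \<open>For two exterior points the distance formula applies. For an interior point z and an exterior point y, the
reflection of y lies on the segment from 0 to y and is no farther from z than y is: the difference of the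
squared distances is (\<rho> - 1/\<rho>)(\<rho> + 1/\<rho> - 2c), where \<rho> = \<bar>y\<bar> and c \<le> 1 is the component of z in
the direction of y, and \<rho> + 1/\<rho> \<ge> 2.\<close>
lemma circle_reflection_contraction:
  "norm (circle_reflection z - circle_reflection y) \<le> norm (z - y)"
proof -
  have mixed: "norm (z - circle_reflection y) \<le> norm (z - y)" if "norm z \<le> 1" "1 < norm y" for z y
  proof -
    define \<rho> where "\<rho> = norm y"
    have nz: "y \<noteq> 0" and \<rho>: "1 < \<rho>" using that by (auto simp: \<rho>_def)
    define c where "c = Re (cnj z * y) / \<rho>"
    have "c \<le> norm z"
      using complex_Re_le_cmod[of "cnj z * y"] \<rho> by (simp add: c_def \<rho>_def norm_mult divide_simps)
    then have c: "c \<le> 1" using that by simp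
    have w: "circle_reflection y = of_real (1 / \<rho>\<^sup>2) * y"
      using that nz by (simp add: circle_reflection_def \<rho>_def field_simps)
        (simp add: complex_norm_square[symmetric])
    have sq: "(norm (z - of_real t * y))\<^sup>2 = (norm z)\<^sup>2 - 2 * t * (c * \<rho>) + t\<^sup>2 * \<rho>\<^sup>2" for t
    proof -
      have "c * \<rho> = Re z * Re y + Im z * Im y" using \<rho> by (simp add: c_def)
      moreover have "\<rho>\<^sup>2 = (Re y)\<^sup>2 + (Im y)\<^sup>2" by (simp add: \<rho>_def cmod_power2)
      ultimately show ?thesis
        unfolding cmod_power2 by (simp add: power2_eq_square algebra_simps)
    qed
    have sq1: "(norm (z - y))\<^sup>2 = (norm z)\<^sup>2 - 2 * (c * \<rho>) + \<rho>\<^sup>2"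
      using sq[of 1] by simp
    have "(norm (z - y))\<^sup>2 - (norm (z - circle_reflection y))\<^sup>2 = (\<rho> - 1/\<rho>) * (\<rho> + 1/\<rho> - 2 * c)"
      unfolding w sq sq1 using \<rho> by (simp add: field_simps power2_eq_square)
    moreover have "0 \<le> (\<rho> - 1/\<rho>) * (\<rho> + 1/\<rho> - 2 * c)"
    proof (rule mult_nonneg_nonneg)
      show "0 \<le> \<rho> - 1/\<rho>" using \<rho> by (simp add: field_simps) (metis less_imp_le mult_mono' mult_1 zero_le_one)
      have "0 \<le> (\<rho> - 1)\<^sup>2 / \<rho>" using \<rho> by simp
      also have "(\<rho> - 1)\<^sup>2 / \<rho> = \<rho> + 1/\<rho> - 2" using \<rho> by (simp add: field_simps power2_eq_square)
      finally show "0 \<le> \<rho> + 1/\<rho> - 2 * c" using c by linarith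
    qed
    ultimately have "(norm (z - circle_reflection y))\<^sup>2 \<le> (norm (z - y))\<^sup>2" by linarith
    then show ?thesis by (rule power2_le_imp_le) simp
  qed
  show ?thesis
  proof (cases "norm z \<le> 1"; cases "norm y \<le> 1")
    assume "\<not> norm z \<le> 1" "\<not> norm y \<le> 1"
    moreover have "norm (circle_reflection z) * norm (circle_reflection y) \<le> 1"
      by (simp add: mult_le_one)
    ultimately show ?thesis
      using dist_circle_reflection_outside[of z y] mult_right_mono[of _ 1 "norm (z - y)"] by simp
  qed (use mixed[of z y] mixed[of y z] in \<open>auto simp: circle_reflection_def norm_minus_commute\<close>)
qed

lemma holomorphic_bounded_on_cball:
  assumes "f holomorphic_on U" "cball 0 r \<subseteq> U"
  obtains B :: real where "\<And>z. norm z \<le> r \<Longrightarrow> norm (f z) \<le> B"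
proof -
  have "continuous_on (cball 0 r) f"
    by (rule holomorphic_on_imp_continuous_on[OF holomorphic_on_subset[OF assms]])
  then have "bounded (f ` cball 0 r)"
    by (rule compact_imp_bounded[OF compact_continuous_image[OF _ compact_cball]])
  then obtain B where "\<And>x. x \<in> f ` cball 0 r \<Longrightarrow> norm x \<le> B"
    unfolding bounded_iff by metis
  then show ?thesis by (intro that[of B]) simp
qed

text \<open>This is the extension of Ahlfors and Becker. With w the reflection of z, the function
F(z) = g(w) + (z - w) g'(w) agrees with g on the disc and behaves like z g'(0) at infinity.
Outside the disc its derivative is dz \<mapsto> g'(w) dz + (z - w) g''(w) dw with \<bar>dw\<bar> = \<bar>w\<bar>^2 \<bar>dz\<bar>, and since
\<bar>z - w\<bar> \<bar>w\<bar> = 1 - \<bar>w\<bar>^2, the strict inequality says exactly that the first term dominates the second.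
Compactness turns this into a uniform lower bound for increments of F at small scale. So F is uniformly
locally injective, and it is proper and injective near infinity, hence injective.\<close>
lemma strict_becker_criterion:
  fixes g :: "complex \<Rightarrow> complex"
  assumes U: "open U" "g holomorphic_on U" "cball 0 1 \<subseteq> U"
    and strict: "\<And>z. norm z \<le> 1 \<Longrightarrow> (1 - (norm z)\<^sup>2) * norm (z * deriv (deriv g) z) < norm (deriv g z)"
  shows "inj_on g (cball 0 1)"
proof -
  define g1 where "g1 = deriv g"
  define g2 where "g2 = deriv g1"
  define g3 where "g3 = deriv g2"
  note gdefs = g1_def g2_def g3_def
  have holo: "g1 holomorphic_on U" "g2 holomorphic_on U" "g3 holomorphic_on U"
    unfolding gdefs by (intro holomorphic_deriv U)+
  have der: "(g has_field_derivative g1 z) (at z)" "(g1 has_field_derivative g2 z) (at z)"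
    "(g2 has_field_derivative g3 z) (at z)" if "norm z \<le> 1" for z
    using holomorphic_derivI[OF U(2,1)] holomorphic_derivI[OF holo(1) U(1)] holomorphic_derivI[OF holo(2) U(1)]
      that U(3) by (auto simp: gdefs subset_iff)
  obtain M0 where M0: "\<And>z. norm z \<le> 1 \<Longrightarrow> norm (g z) \<le> M0"
    by (rule holomorphic_bounded_on_cball[OF U(2,3)]) (rule that; assumption)
  obtain M1 where M1: "\<And>z. norm z \<le> 1 \<Longrightarrow> norm (g1 z) \<le> M1"
    by (rule holomorphic_bounded_on_cball[OF holo(1) U(3)]) (rule that; assumption)
  obtain M2 where M2: "\<And>z. norm z \<le> 1 \<Longrightarrow> norm (g2 z) \<le> M2"
    by (rule holomorphic_bounded_on_cball[OF holo(2) U(3)]) (rule that; assumption)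
  obtain M3 where M3: "\<And>z. norm z \<le> 1 \<Longrightarrow> norm (g3 z) \<le> M3"
    by (rule holomorphic_bounded_on_cball[OF holo(3) U(3)]) (rule that; assumption)
  define M where "M = max (max M0 M1) (max M2 M3)"
  have M: "norm (g z) \<le> M" "norm (g1 z) \<le> M" "norm (g2 z) \<le> M" "norm (g3 z) \<le> M" if "norm z \<le> 1" for z
    using M0[OF that] M1[OF that] M2[OF that] M3[OF that] by (auto simp: M_def)
  have M_nonneg: "0 \<le> M" using M(1)[of 0] norm_ge_zero[of "g 0"] by (simp only: norm_zero) linarith
  have taylor: "norm (f v - f w - f' w * (v - w)) \<le> M * (norm (v - w))\<^sup>2"
    if f: "\<And>z. norm z \<le> 1 \<Longrightarrow> (f has_field_derivative f' z) (at z)"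
      and f': "\<And>z. norm z \<le> 1 \<Longrightarrow> (f' has_field_derivative f'' z) (at z)"
      and b: "\<And>z. norm z \<le> 1 \<Longrightarrow> norm (f'' z) \<le> M" and vw: "norm v \<le> 1" "norm w \<le> 1" for f f' f'' :: "complex \<Rightarrow> complex" and v w
  proof -
    define D where "D i = (if i = 0 then f else if i = 1 then f' else f'')" for i :: nat
    have "norm (D 0 v - (\<Sum>i\<le>1. D i w * (v - w) ^ i / fact i)) \<le> M * norm (v - w) ^ Suc 1 / fact 1"
    proof (rule complex_Taylor[OF convex_cball[of 0 1]])
      fix i :: nat and x :: complex assume "x \<in> cball 0 1" "i \<le> 1"
      then have "i = 0 \<or> i = 1" "norm x \<le> 1" by auto
      then show "(D i has_field_derivative D (Suc i) x) (at x within cball 0 1)"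
        using f[of x] f'[of x] by (auto simp: D_def intro: has_field_derivative_at_within)
    qed (use b vw in \<open>auto simp: D_def\<close>)
    then show ?thesis by (simp add: D_def power2_eq_square diff_diff_eq)
  qed
  note taylor_g = taylor[OF der(1,2) M(3)] and taylor_g1 = taylor[OF der(2,3) M(4)]
  have lip_g1: "norm (g1 v - g1 w) \<le> M * norm (v - w)" if "norm v \<le> 1" "norm w \<le> 1" for v w
    by (rule field_differentiable_bound[OF convex_cball[of 0 1], of _ g2])
       (use that der(2) M(3) in \<open>auto intro: has_field_derivative_at_within\<close>)
  \<comment> \<open>the margin in the strict inequality; its minimum c over the closed disc is positive\<close>
  define h where "h w = norm (g1 w) - (1 - (norm w)\<^sup>2) * norm (w * g2 w)" for w
  have "continuous_on (cball 0 1) h"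
    unfolding h_def using holo U(3)
    by (intro continuous_intros) (auto intro: holomorphic_on_imp_continuous_on holomorphic_on_subset)
  then obtain w0 where w0: "norm w0 \<le> 1" "\<And>w. norm w \<le> 1 \<Longrightarrow> h w0 \<le> h w"
    using continuous_attains_inf[of "cball 0 (1::real) :: complex set" h] by (auto simp: Ball_def)
  define c where "c = h w0"
  have c: "0 < c" using strict[OF w0(1)] by (simp add: c_def h_def gdefs)
  have hc: "c \<le> h w" if "norm w \<le> 1" for w using w0(2)[OF that] by (simp add: c_def)
  have sq_le: "(norm w)\<^sup>2 \<le> 1" if "norm w \<le> 1" for w :: complex
    using that by (simp add: abs_square_le_1)
  have g1c: "c \<le> norm (g1 w)" if "norm w \<le> 1" for w
  proof -
    have "0 \<le> (1 - (norm w)\<^sup>2) * norm (w * g2 w)" using sq_le[OF that] by simp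
    then show ?thesis using hc[OF that] by (simp add: h_def)
  qed
  define F where "F z = g (circle_reflection z) + (z - circle_reflection z) * g1 (circle_reflection z)" for z
  \<comment> \<open>expanding g at w leaves the main term (z - y) g'(w), a quadratic error and the term
    (y - v)(g'(w) - g'(v)), which vanishes for y in the disc\<close>
  have incr: "norm (z - y) * norm (g1 w) - M * (norm (w - v))\<^sup>2 - norm (y - v) * norm (g1 w - g1 v) \<le> norm (F z - F y)"
    if "w = circle_reflection z" "v = circle_reflection y" for z y w v
  proof -
    have eq: "(z - y) * g1 w = (F z - F y) + (g v - g w - g1 w * (v - w)) - (y - v) * (g1 w - g1 v)"
      unfolding F_def that[symmetric] by (simp add: algebra_simps)
    have "norm ((z - y) * g1 w) \<le> norm (F z - F y) + norm (g v - g w - g1 w * (v - w)) + norm ((y - v) * (g1 w - g1 v))"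
      unfolding eq by (intro order_trans[OF norm_triangle_ineq4] add_right_mono norm_triangle_ineq)
    moreover have "norm (g v - g w - g1 w * (v - w)) \<le> M * (norm (v - w))\<^sup>2"
      by (rule taylor_g) (simp_all add: that)
    ultimately show ?thesis by (simp add: norm_mult norm_minus_commute)
  qed
  \<comment> \<open>y is taken in the disc whenever one of the two points is, so that the third term of the increment
    only matters for two exterior points\<close>
  have local_est: "norm (z - y) * (c - 4 * M * norm (z - y)) \<le> norm (F z - F y)"
    if cases: "norm y \<le> 1 \<or> (1 < norm y \<and> 1 < norm z)" for z y
  proof -
    define w where "w = circle_reflection z"
    define v where "v = circle_reflection y"
    define d where "d = norm (z - y)"
    have in_disc: "norm w \<le> 1" "norm v \<le> 1" by (simp_all add: w_def v_def)
    have wv: "norm (w - v) \<le> d" unfolding w_def v_def d_def by (rule circle_reflection_contraction)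
    have third: "norm (y - v) * norm (g1 w - g1 v) \<le> d * ((1 - (norm w)\<^sup>2) * norm (w * g2 w) + 3 * M * d)"
    proof (cases "norm y \<le> 1")
      case True
      then have "y = v" by (simp add: v_def circle_reflection_def)
      then show ?thesis using sq_le[OF in_disc(1)] M_nonneg by (simp add: d_def)
    next
      case False
      then have out: "1 < norm y" "1 < norm z" using cases by auto
      have yv: "norm (y - v) * norm (w - v) = (1 - (norm v)\<^sup>2) * norm w * d"
        using norm_sub_circle_reflection[OF out(1)] dist_circle_reflection_outside[OF out(2,1)]
        unfolding w_def v_def d_def by (metis mult.assoc mult.commute mult.left_commute)
      have "norm (g1 w - g1 v) = norm (g1 v - g1 w)" by (rule norm_minus_commute)
      also have "\<dots> \<le> norm (g2 w * (v - w)) + norm (g1 v - g1 w - g2 w * (v - w))"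
        by (metis add.commute diff_add_cancel norm_triangle_ineq)
      also have "\<dots> \<le> norm (g2 w * (v - w)) + M * (norm (v - w))\<^sup>2"
        using taylor_g1[of v w] in_disc by simp
      also have "\<dots> = norm (w - v) * (norm (g2 w) + M * norm (w - v))"
        unfolding norm_mult norm_minus_commute[of v w] power2_eq_square by (simp add: distrib_left mult_ac)
      finally have "norm (y - v) * norm (g1 w - g1 v) \<le> norm (y - v) * (norm (w - v) * (norm (g2 w) + M * norm (w - v)))"
        by (rule mult_left_mono) simp
      also have "\<dots> = d * ((1 - (norm v)\<^sup>2) * norm w * (norm (g2 w) + M * norm (w - v)))"
        by (simp add: mult.assoc[symmetric] yv) 
      also have "\<dots> \<le> d * ((1 - (norm w)\<^sup>2) * norm (w * g2 w) + 3 * M * d)"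
      proof (rule mult_left_mono)
        have a1: "0 \<le> 1 - (norm v)\<^sup>2" "1 - (norm v)\<^sup>2 \<le> 1" using sq_le[OF in_disc(2)] by auto
        have "(norm w)\<^sup>2 - (norm v)\<^sup>2 = (norm w - norm v) * (norm w + norm v)"
          by (simp add: power2_eq_square algebra_simps)
        also have "\<dots> \<le> norm (w - v) * 2"
          using in_disc norm_triangle_ineq2[of w v] by (intro mult_mono) auto
        also have "\<dots> \<le> 2 * d" using wv by simp
        finally have a2: "1 - (norm v)\<^sup>2 \<le> (1 - (norm w)\<^sup>2) + 2 * d" by simp
        have wg: "norm (w * g2 w) \<le> M"
          using mult_mono[of "norm w" 1 "norm (g2 w)" M] in_disc(1) M(3)[OF in_disc(1)] by (simp add: norm_mult)
        have "(1 - (norm v)\<^sup>2) * norm w * norm (g2 w) \<le> ((1 - (norm w)\<^sup>2) + 2 * d) * norm (w * g2 w)"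
          using mult_right_mono[OF a2, of "norm (w * g2 w)"] by (simp add: norm_mult mult.assoc)
        also have "\<dots> \<le> (1 - (norm w)\<^sup>2) * norm (w * g2 w) + 2 * d * M"
          using mult_left_mono[OF wg, of "2 * d"] by (simp add: distrib_right d_def)
        finally have b1: "(1 - (norm v)\<^sup>2) * norm w * norm (g2 w) \<le> (1 - (norm w)\<^sup>2) * norm (w * g2 w) + 2 * d * M" .
        have "(1 - (norm v)\<^sup>2) * norm w \<le> 1" using a1 in_disc by (intro mult_le_one) auto
        then have b2: "(1 - (norm v)\<^sup>2) * norm w * (M * norm (w - v)) \<le> 1 * (M * d)"
          using a1 wv M_nonneg by (intro mult_mono) auto
        show "(1 - (norm v)\<^sup>2) * norm w * (norm (g2 w) + M * norm (w - v)) \<le> (1 - (norm w)\<^sup>2) * norm (w * g2 w) + 3 * M * d"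
          using b1 b2 unfolding distrib_left by (simp add: mult.assoc mult.commute[of d M])
      qed (simp add: d_def)
      finally show ?thesis .
    qed
    have "M * (norm (w - v))\<^sup>2 \<le> M * d\<^sup>2"
      using wv M_nonneg by (intro mult_left_mono power_mono) auto
    moreover have "d * c \<le> d * (norm (g1 w) - (1 - (norm w)\<^sup>2) * norm (w * g2 w))"
      using hc[OF in_disc(1)] by (intro mult_left_mono) (auto simp: h_def d_def)
    ultimately have "d * c - 4 * M * d\<^sup>2 \<le> norm (F z - F y)"
      using incr[OF w_def v_def] third unfolding d_def[symmetric]
      by (simp add: algebra_simps power2_eq_square)
    then show ?thesis unfolding d_def by (simp add: algebra_simps power2_eq_square)
  qed
  \<comment> \<open>the missing case has z in the disc and y outside; it follows by exchanging the points\<close>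
  have local_est': "norm (z - y) * (c - 4 * M * norm (z - y)) \<le> norm (F z - F y)" for z y
  proof (cases "norm y \<le> 1 \<or> (1 < norm y \<and> 1 < norm z)")
    case True
    then show ?thesis by (rule local_est)
  next
    case False
    then have "norm z \<le> 1 \<or> (1 < norm z \<and> 1 < norm y)" by auto
    from local_est[OF this] show ?thesis by (simp only: norm_minus_commute)
  qed
  define \<delta> where "\<delta> = c / (4 * M + 1)"
  \<comment> \<open>far out, the error terms of the increment are at most 3M/R times \<bar>z - y\<bar>; this choice makes them at most half of the main term\<close>
  define R where "R = 2 + 6 * M / c"
  have R: "2 \<le> R" "3 * M / R \<le> c / 2"
    using c M_nonneg by (simp_all add: R_def field_simps)
  have "inj F"
  proof (rule inj_of_locally_inj_proper)
    have cr: "continuous_on UNIV circle_reflection"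
      unfolding continuous_on_iff dist_norm
      using circle_reflection_contraction le_less_trans by blast
    have comp: "continuous_on UNIV (\<lambda>z. f (circle_reflection z))" if "f holomorphic_on U" for f
      by (rule continuous_on_compose2[OF holomorphic_on_imp_continuous_on[OF that] cr]) (use U(3) in auto)
    show "continuous_on UNIV F"
      unfolding F_def by (intro continuous_intros comp cr U(2) holo(1))
    show "0 < \<delta>" using c M_nonneg by (simp add: \<delta>_def)
    show "F z \<noteq> F y" if "z \<noteq> y" "dist z y < \<delta>" for z y
    proof
      assume "F z = F y"
      then have "norm (z - y) * (c - 4 * M * norm (z - y)) \<le> 0" using local_est'[of z y] by simp
      then have "c \<le> 4 * M * norm (z - y)" using that(1) by (simp add: mult_le_0_iff)
      moreover have "norm (z - y) * (4 * M + 1) < c"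
        using that(2) M_nonneg by (simp add: \<delta>_def dist_norm pos_less_divide_eq)
      ultimately show False using norm_ge_zero[of "z - y"] by (simp add: algebra_simps del: norm_ge_zero)
    qed
    show "bounded (F -` B)" if B: "bounded B" for B
    proof -
      obtain b where b: "\<And>x. x \<in> B \<Longrightarrow> norm x \<le> b" using B by (auto simp: bounded_iff)
      have "norm z \<le> (b + 2 * M) / c" if "F z \<in> B" for z
      proof -
        define w where "w = circle_reflection z"
        have w: "norm w \<le> 1" by (simp add: w_def)
        have "z * g1 w = F z - g w + w * g1 w" by (simp add: F_def w_def algebra_simps)
        then have "norm (z * g1 w) \<le> norm (F z) + norm (g w) + norm (w * g1 w)"
          by (metis add_right_mono norm_triangle_ineq norm_triangle_ineq4 order_trans)
        also have "norm (w * g1 w) \<le> M"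
          using mult_mono[of "norm w" 1 "norm (g1 w)" M] w M(2)[OF w] by (simp add: norm_mult)
        finally have "norm z * norm (g1 w) \<le> b + 2 * M"
          using b[OF that] M(1)[OF w] by (simp add: norm_mult)
        moreover have "norm z * c \<le> norm z * norm (g1 w)" by (rule mult_left_mono[OF g1c[OF w]]) simp
        ultimately show ?thesis using c by (simp add: pos_le_divide_eq)
      qed
      then show ?thesis unfolding bounded_iff by blast
    qed
    show "z = y" if far: "R \<le> norm z" "R \<le> norm y" and eq: "F z = F y" for z y
    proof -
      define w where "w = circle_reflection z"
      define v where "v = circle_reflection y"
      define d where "d = norm (z - y)"
      have out: "1 < norm z" "1 < norm y" using far R by auto
      have nw: "norm w = 1 / norm z" "norm v = 1 / norm y"
        using out by (auto simp: w_def v_def circle_reflection_def norm_divide)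
      have in_disc: "norm w \<le> 1" "norm v \<le> 1" by (simp_all add: w_def v_def)
      have wR: "norm w \<le> 1 / R" using far R by (auto simp: nw intro!: divide_left_mono mult_pos_pos)
      have D: "norm (w - v) = norm w * norm v * d"
        unfolding w_def v_def d_def by (rule dist_circle_reflection_outside[OF out])
      have "norm (y - v) * norm (g1 w - g1 v) \<le> norm (y - v) * (M * norm (w - v))"
        by (rule mult_left_mono[OF lip_g1[OF in_disc]]) simp
      also have "\<dots> = M * d * ((norm (y - v) * norm v) * norm w)" by (simp add: D)
      also have "\<dots> \<le> M * d * (1 * (1 / R))"
        using norm_sub_circle_reflection[OF out(2)] wR M_nonneg
        by (intro mult_left_mono mult_mono) (auto simp: v_def d_def)
      finally have t3: "norm (y - v) * norm (g1 w - g1 v) \<le> M * d / R" by simp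
      have "norm (w - v) \<le> 2" using norm_triangle_ineq4[of w v] in_disc by linarith
      moreover have "norm (w - v) \<le> d / R"
      proof -
        have "norm w * norm v * d \<le> 1 / R * 1 * d"
          using wR in_disc R by (intro mult_right_mono mult_mono) (auto simp: d_def)
        then show ?thesis by (simp add: D)
      qed
      ultimately have "(norm (w - v))\<^sup>2 \<le> 2 * (d / R)"
        unfolding power2_eq_square by (intro mult_mono) auto
      then have t1: "M * (norm (w - v))\<^sup>2 \<le> M * (2 * (d / R))"
        using M_nonneg by (rule mult_left_mono)
      have "d * c \<le> d * norm (g1 w)" by (rule mult_left_mono[OF g1c[OF in_disc(1)]]) (simp add: d_def)
      moreover have "d * norm (g1 w) - M * (norm (w - v))\<^sup>2 - norm (y - v) * norm (g1 w - g1 v) \<le> 0"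
        using incr[OF w_def v_def] eq by (simp add: d_def)
      moreover define e where "e = M * d / R"
      moreover have "M * (norm (w - v))\<^sup>2 \<le> 2 * e" using t1 by (simp add: e_def mult_ac)
      moreover have "norm (y - v) * norm (g1 w - g1 v) \<le> e" using t3 by (simp add: e_def)
      ultimately have "d * c \<le> 3 * e" by linarith
      also have "3 * e = d * (3 * M / R)" by (simp add: e_def)
      also have "\<dots> \<le> d * (c / 2)" by (rule mult_left_mono[OF R(2)]) (simp add: d_def)
      finally have "d * c \<le> 0" by (simp add: mult.commute)
      then have "d = 0" using c by (simp add: mult_le_0_iff d_def)
      then show "z = y" by (simp add: d_def)
    qed
  qed
  moreover have "F z = g z" if "z \<in> cball 0 1" for z
    using that by (simp add: F_def circle_reflection_def)
  ultimately show ?thesis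
    by (metis (no_types, lifting) injD inj_onI)
qed

text \<open>For 0 < r < 1 the function z \<mapsto> f(rz) satisfies the strict inequality on the closed disc, because
1 - \<bar>z\<bar>^2 < 1 - \<bar>rz\<bar>^2 unless z = 0, where the left side vanishes anyway. Any two points of the open
disc lie in a disc of some radius r < 1.\<close>
theorem becker_criterion:
  fixes f :: "complex \<Rightarrow> complex"
  assumes f: "f holomorphic_on unit_disc"
    and nz: "\<And>z. z \<in> unit_disc \<Longrightarrow> deriv f z \<noteq> 0"
    and bound: "\<And>z. z \<in> unit_disc \<Longrightarrow> (1 - (norm z)\<^sup>2) * norm (z * deriv (deriv f) z) \<le> norm (deriv f z)"
  shows "inj_on f unit_disc"
proof -
  have df: "deriv f holomorphic_on unit_disc" by (rule holomorphic_deriv[OF f open_ball])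
  have scaled: "inj_on (\<lambda>z. f (of_real r * z)) (cball 0 1)" if r: "0 < r" "r < 1" for r
  proof (rule strict_becker_criterion)
    define U where "U = ball (0::complex) (1 / r)"
    have rU: "of_real r * z \<in> unit_disc" if "z \<in> U" for z
      using that r by (simp add: U_def norm_mult field_simps)
    show "open U" by (simp add: U_def)
    have "1 < 1 / r" using r by simp
    then show "cball 0 1 \<subseteq> U" unfolding U_def by (auto simp del: less_divide_eq_1_pos)
    have D: "((\<lambda>z. h (of_real r * z)) has_field_derivative deriv h (of_real r * z) * of_real r) (at z)"
      if "h holomorphic_on unit_disc" "z \<in> U" for h z
      by (rule DERIV_chain2[OF holomorphic_derivI[OF that(1) open_ball rU[OF that(2)]] DERIV_cmult_Id])
    show "(\<lambda>z. f (of_real r * z)) holomorphic_on U"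
      using D[OF f] by (meson holomorphic_onI field_differentiable_at_within field_differentiable_def)
    have d1: "deriv (\<lambda>z. f (of_real r * z)) z = deriv f (of_real r * z) * of_real r" if "z \<in> U" for z
      by (rule DERIV_imp_deriv[OF D[OF f that]])
    have d2: "deriv (deriv (\<lambda>z. f (of_real r * z))) z = deriv (deriv f) (of_real r * z) * of_real r * of_real r" if z: "z \<in> U" for z
    proof (rule DERIV_imp_deriv)
      have "((\<lambda>z. deriv f (of_real r * z) * of_real r) has_field_derivative deriv (deriv f) (of_real r * z) * of_real r * of_real r) (at z)"
        by (rule DERIV_cmult_right[OF D[OF df z]])
      then show "(deriv (\<lambda>z. f (of_real r * z)) has_field_derivative deriv (deriv f) (of_real r * z) * of_real r * of_real r) (at z)"
        by (rule has_field_derivative_transform_within_open[OF _ \<open>open U\<close> z]) (simp add: d1)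
    qed
    fix z :: complex assume z: "norm z \<le> 1"
    then have zU: "z \<in> U" using \<open>cball 0 1 \<subseteq> U\<close> by auto
    define u where "u = of_real r * z"
    have u: "u \<in> unit_disc" unfolding u_def by (rule rU[OF zU])
    have "(1 - (norm z)\<^sup>2) * norm (u * deriv (deriv f) u) < norm (deriv f u)"
    proof (cases "u * deriv (deriv f) u = 0")
      case True
      show ?thesis unfolding True using nz[OF u] by simp
    next
      case False
      then have "norm z \<noteq> 0" by (auto simp: u_def)
      have "norm u < norm z" using r \<open>norm z \<noteq> 0\<close> by (simp add: u_def norm_mult)
      then have "(norm u)\<^sup>2 < (norm z)\<^sup>2" by (intro power_strict_mono) auto
      then have "(1 - (norm z)\<^sup>2) * norm (u * deriv (deriv f) u) < (1 - (norm u)\<^sup>2) * norm (u * deriv (deriv f) u)"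
        using False by (intro mult_strict_right_mono) (auto simp del: norm_mult)
      also have "\<dots> \<le> norm (deriv f u)" by (rule bound[OF u])
      finally show ?thesis .
    qed
    then have "r * ((1 - (norm z)\<^sup>2) * norm (u * deriv (deriv f) u)) < r * norm (deriv f u)"
      using r by simp
    then show "(1 - (norm z)\<^sup>2) * norm (z * deriv (deriv (\<lambda>z. f (of_real r * z))) z) < norm (deriv (\<lambda>z. f (of_real r * z)) z)"
      using r unfolding d1[OF zU] d2[OF zU] u_def[symmetric] by (simp add: norm_mult u_def mult_ac)
  qed
  show ?thesis
  proof (rule inj_onI)
    fix a b assume ab: "a \<in> unit_disc" "b \<in> unit_disc" "f a = f b"
    then have "max (norm a) (norm b) < 1" "0 \<le> max (norm a) (norm b)" by (auto simp: le_max_iff_disj)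
    then obtain r where r: "max (norm a) (norm b) < r" "r < 1" using dense by blast
    then have r0: "0 < r" using \<open>0 \<le> max (norm a) (norm b)\<close> by linarith
    have "a / of_real r \<in> cball 0 1" "b / of_real r \<in> cball 0 1"
      using r r0 by (auto simp: norm_divide field_simps)
    moreover have "f (of_real r * (a / of_real r)) = f (of_real r * (b / of_real r))" using ab r0 by simp
    ultimately have "a / of_real r = b / of_real r" using scaled[OF r0 r(2)] by (meson inj_onD)
    then show "a = b" using r0 by simp
  qed
qed

section \<open>Weighted area of conformal images\<close>

lemma integral_real2_iterated:
  fixes F :: "real^2 \<Rightarrow> real"
  assumes F: "continuous_on (cbox (vector [a, c]) (vector [b, d])) F"
  shows "integral (cbox (vector [a, c]) (vector [b, d])) F =
    integral {a..b} (\<lambda>x. integral {c..d} (\<lambda>y. F (vector [x, y])))"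
proof -
  define g :: "real \<times> real \<Rightarrow> real^2" where "g p = vector [fst p, snd p]" for p
  define h :: "real^2 \<Rightarrow> real \<times> real" where "h v = (v $ 1, v $ 2)" for v
  have hg: "h (g p) = p" for p by (simp add: h_def g_def vector_2)
  have gh: "g (h v) = v" for v by (simp add: h_def g_def vec_eq_iff forall_2 vector_2)
  have img_h: "h ` cbox u v = cbox (u $ 1, u $ 2) (v $ 1, v $ 2)" for u v
  proof -
    have "p \<in> h ` cbox u v \<longleftrightarrow> g p \<in> cbox u v" for p
      using hg gh by (metis imageE imageI)
    moreover have "g p \<in> cbox u v \<longleftrightarrow> p \<in> cbox (u $ 1, u $ 2) (v $ 1, v $ 2)" for p
      by (cases p) (auto simp: g_def mem_box_cart forall_2 vector_2 cbox_Pair_eq)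
    ultimately show ?thesis by blast
  qed
  have img_g: "g ` cbox u v = cbox (g u) (g v)" for u v
  proof -
    have "x \<in> g ` cbox u v \<longleftrightarrow> h x \<in> cbox u v" for x
      using hg gh by (metis imageE imageI)
    moreover have "h x \<in> cbox u v \<longleftrightarrow> x \<in> cbox (g u) (g v)" for x
      by (cases u; cases v) (auto simp: h_def g_def mem_box_cart forall_2 vector_2 cbox_Pair_eq)
    ultimately show ?thesis by blast
  qed
  have cont_g: "continuous_on A g" for A
  proof (rule linear_continuous_on, rule linear_conv_bounded_linear[THEN iffD1], rule linearI)
    show "g (p + p') = g p + g p'" "g (r *\<^sub>R p) = r *\<^sub>R g p" for p p' r
      by (simp_all add: g_def vec_eq_iff forall_2 vector_2)
  qed
  have "measure lborel (g ` cbox u v) = 1 * measure lborel (cbox u v)" for u v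
  proof (cases "cbox u v = {}")
    case True then show ?thesis by simp
  next
    case False
    then have "cbox (g u) (g v) \<noteq> {}" using img_g by (metis image_is_empty)
    then have "measure lborel (cbox (g u) (g v)) = (fst v - fst u) * (snd v - snd u)"
      by (subst content_cbox_cart) (auto simp: UNIV_2 g_def vector_2)
    moreover have "measure lborel (cbox u v) = (fst v - fst u) * (snd v - snd u)"
    proof -
      obtain u1 u2 v1 v2 where uv: "u = (u1, u2)" "v = (v1, v2)" by (metis surj_pair)
      then have "u1 \<le> v1" "u2 \<le> v2" using False by (auto simp: cbox_Pair_eq)
      then show ?thesis unfolding uv content_Pair by simp
    qed
    ultimately show ?thesis by (simp add: img_g)
  qed
  moreover have "(F has_integral integral (cbox (vector [a, c]) (vector [b, d])) F)
      (cbox (vector [a, c]) (vector [b, d]))"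
    using F by (simp add: integrable_continuous integrable_integral)
  ultimately have "((\<lambda>p. F (g p)) has_integral (1/1) *\<^sub>R integral (cbox (vector [a, c]) (vector [b, d])) F)
      (h ` cbox (vector [a, c]) (vector [b, d]))"
    using hg gh img_g img_h cont_g[of UNIV]
    by (intro has_integral_twiddle) (auto simp: continuous_on_eq_continuous_at)
  then have "integral (cbox (a, c) (b, d)) (\<lambda>p. F (g p)) = integral (cbox (vector [a, c]) (vector [b, d])) F"
    by (auto simp: img_h vector_2 intro: integral_unique)
  moreover have "continuous_on (cbox (a, c) (b, d)) (\<lambda>p. F (g p))"
  proof (rule continuous_on_compose2[OF F cont_g])
    show "g ` cbox (a, c) (b, d) \<subseteq> cbox (vector [a, c]) (vector [b, d])"
      unfolding img_g by (simp add: g_def)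
  qed
  ultimately show ?thesis
    using integral_prod_continuous[of a c b d "\<lambda>p. F (g p)"] by (simp add: g_def)
qed

text \<open>The plane as a space of real vectors, in which Jacobian determinants are taken.\<close>
definition complex_of_vec2 :: "real^2 \<Rightarrow> complex" where "complex_of_vec2 v = Complex (v $ 1) (v $ 2)"
definition vec2_of_complex :: "complex \<Rightarrow> real^2" where "vec2_of_complex z = vector [Re z, Im z]"

lemma complex_of_vec2_of_complex [simp]: "complex_of_vec2 (vec2_of_complex z) = z" by (simp add: complex_of_vec2_def vec2_of_complex_def vector_2)
lemma vec2_of_complex_of_vec2 [simp]: "vec2_of_complex (complex_of_vec2 v) = v" by (simp add: complex_of_vec2_def vec2_of_complex_def vec_eq_iff forall_2 vector_2)

lemma bounded_linear_complex_of_vec2: "bounded_linear complex_of_vec2"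
  by (rule linear_conv_bounded_linear[THEN iffD1], rule linearI)
     (simp_all add: complex_of_vec2_def complex_eq_iff)

lemma bounded_linear_vec2_of_complex: "bounded_linear vec2_of_complex"
  by (rule linear_conv_bounded_linear[THEN iffD1], rule linearI)
     (simp_all add: vec2_of_complex_def vec_eq_iff forall_2 vector_2)

text \<open>The Jacobian of a holomorphic map is the squared modulus of its derivative, since that derivative acts
as multiplication by a complex number.\<close>
lemma det_complex_multiplication: "det (matrix (\<lambda>v. vec2_of_complex (D * complex_of_vec2 v))) = (norm D)\<^sup>2"
  by (simp add: det_2 matrix_def vec2_of_complex_def complex_of_vec2_def vector_2 axis_def cmod_power2)
     (simp add: power2_eq_square)

text \<open>An injective holomorphic map transports the weighted area with density \<bar>h'\<bar>^2 (w \<circ> h) to the one with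
density w, and the weighted area of the image is at most that of any rectangle around it.\<close>
lemma conformal_weighted_area_le:
  fixes h :: "complex \<Rightarrow> complex" and w :: "complex \<Rightarrow> real"
  assumes U: "open U" "h holomorphic_on U" 
    and S: "cbox (Complex a c) (Complex b d) \<subseteq> U"
    and inj: "inj_on h (cbox (Complex a c) (Complex b d))"
    and img: "h ` cbox (Complex a c) (Complex b d) \<subseteq> cbox (Complex a' c') (Complex b' d')"
    and w: "continuous_on UNIV w" "\<And>z. 0 \<le> w z"
  shows "integral {a..b} (\<lambda>x. integral {c..d} (\<lambda>y. (norm (deriv h (Complex x y)))\<^sup>2 * w (h (Complex x y))))
    \<le> integral {a'..b'} (\<lambda>x. integral {c'..d'} (\<lambda>y. w (Complex x y)))"
proof -
  define S where "S = cbox (vector [a, c] :: real^2) (vector [b, d])"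
  define T where "T = cbox (vector [a', c'] :: real^2) (vector [b', d'])"
  define g where "g v = vec2_of_complex (h (complex_of_vec2 v))" for v
  define g' where "g' v u = vec2_of_complex (deriv h (complex_of_vec2 v) * complex_of_vec2 u)" for v u
  have S_iff: "v \<in> S \<longleftrightarrow> complex_of_vec2 v \<in> cbox (Complex a c) (Complex b d)" for v
    by (auto simp: S_def mem_box_cart forall_2 vector_2 in_cbox_complex_iff complex_of_vec2_def)
  have T_iff: "v \<in> T \<longleftrightarrow> complex_of_vec2 v \<in> cbox (Complex a' c') (Complex b' d')" for v
    by (auto simp: T_def mem_box_cart forall_2 vector_2 in_cbox_complex_iff complex_of_vec2_def)
  have cont_complex_of_vec2: "continuous_on A complex_of_vec2" for A
    by (simp add: bounded_linear_complex_of_vec2 linear_continuous_on)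
  have cont_wT: "continuous_on A (\<lambda>v. w (complex_of_vec2 v))" for A
    by (rule continuous_on_compose2[OF w(1) cont_complex_of_vec2]) auto
  have der: "(g has_derivative g' v) (at v within S)" if "v \<in> S" for v
  proof -
    have "(h has_field_derivative deriv h (complex_of_vec2 v)) (at (complex_of_vec2 v))"
      using U S that S_iff by (meson holomorphic_derivI subsetD)
    then have "(h has_derivative (*) (deriv h (complex_of_vec2 v))) (at (complex_of_vec2 v))"
      by (simp add: has_field_derivative_def)
    then have "((\<lambda>v. h (complex_of_vec2 v)) has_derivative (\<lambda>u. deriv h (complex_of_vec2 v) * complex_of_vec2 u)) (at v within S)"
      using has_derivative_compose[OF bounded_linear_imp_has_derivative[OF bounded_linear_complex_of_vec2]]
      by (metis has_derivative_at_withinI)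
    then show ?thesis
      unfolding g_def g'_def
      by (rule bounded_linear.has_derivative[OF bounded_linear_vec2_of_complex])
  qed
  have inj_g: "inj_on g S"
  proof (rule inj_onI)
    fix u v assume "u \<in> S" "v \<in> S" "g u = g v"
    then have "h (complex_of_vec2 u) = h (complex_of_vec2 v)" by (metis g_def complex_of_vec2_of_complex)
    then have "complex_of_vec2 u = complex_of_vec2 v" using inj \<open>u \<in> S\<close> \<open>v \<in> S\<close> S_iff by (meson inj_onD)
    then show "u = v" by (metis vec2_of_complex_of_vec2)
  qed
  define J where "J v = \<bar>det (matrix (g' v))\<bar> * w (complex_of_vec2 (g v))" for v
  have J: "J v = (norm (deriv h (complex_of_vec2 v)))\<^sup>2 * w (h (complex_of_vec2 v))" for v
    by (simp add: J_def g'_def[abs_def] det_complex_multiplication g_def)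
  have contJ: "continuous_on S J"
  proof -
    have dh: "deriv h holomorphic_on U" by (rule holomorphic_deriv[OF U(2,1)])
    have sub: "complex_of_vec2 ` S \<subseteq> U" using S S_iff by blast
    have "continuous_on S (\<lambda>v. deriv h (complex_of_vec2 v))"
      by (rule continuous_on_compose2[OF holomorphic_on_imp_continuous_on[OF dh] cont_complex_of_vec2 sub])
    moreover have ch: "continuous_on S (\<lambda>v. h (complex_of_vec2 v))"
      by (rule continuous_on_compose2[OF holomorphic_on_imp_continuous_on[OF U(2)] cont_complex_of_vec2 sub])
    moreover have "continuous_on S (\<lambda>v. w (h (complex_of_vec2 v)))"
      by (rule continuous_on_compose2[OF w(1) ch]) auto
    ultimately show ?thesis unfolding J by (intro continuous_intros)
  qed
  have S_meas: "S \<in> sets lebesgue" by (simp add: S_def)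
  have "J absolutely_integrable_on S"
    using contJ unfolding S_def by (rule absolutely_integrable_continuous)
  then have "(\<lambda>v. \<bar>det (matrix (g' v))\<bar> *\<^sub>R (vec (w (complex_of_vec2 (g v))) :: real^1)) absolutely_integrable_on S"
    by (simp add: absolutely_integrable_on_1_iff J_def[abs_def])
  moreover have "integral S (\<lambda>v. \<bar>det (matrix (g' v))\<bar> *\<^sub>R (vec (w (complex_of_vec2 (g v))) :: real^1)) = vec (integral S J)"
    by (simp add: integral_on_1_eq J_def[abs_def] vec_eq_iff)
  ultimately have *: "(\<lambda>v. vec (w (complex_of_vec2 v)) :: real^1) absolutely_integrable_on g ` S \<and>
     integral (g ` S) (\<lambda>v. vec (w (complex_of_vec2 v)) :: real^1) = vec (integral S J)"
    using has_absolute_integral_change_of_variables[OF S_meas der inj_g, of "\<lambda>v. vec (w (complex_of_vec2 v)) :: real^1" "vec (integral S J)"]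
    by simp
  then have int_gS: "(\<lambda>v. w (complex_of_vec2 v)) integrable_on g ` S" 
    and eq: "integral (g ` S) (\<lambda>v. w (complex_of_vec2 v)) = integral S J"
    by (simp_all add: absolutely_integrable_on_1_iff integral_on_1_eq vec_eq_iff set_lebesgue_integral_eq_integral(1))
  have "integral S J \<le> integral T (\<lambda>v. w (complex_of_vec2 v))"
    unfolding eq[symmetric]
  proof (rule integral_subset_le[OF _ int_gS])
    show "g ` S \<subseteq> T" using img S_iff T_iff by (fastforce simp: g_def)
    show "(\<lambda>v. w (complex_of_vec2 v)) integrable_on T"
      unfolding T_def by (rule integrable_continuous[OF cont_wT])
  qed (use w in auto)
  moreover have "integral S J = integral {a..b} (\<lambda>x. integral {c..d} (\<lambda>y. (norm (deriv h (Complex x y)))\<^sup>2 * w (h (Complex x y))))"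
    unfolding S_def by (subst integral_real2_iterated) (use contJ S_def in \<open>simp_all add: J complex_of_vec2_def vector_2\<close>)
  moreover have "integral T (\<lambda>v. w (complex_of_vec2 v)) = integral {a'..b'} (\<lambda>x. integral {c'..d'} (\<lambda>y. w (Complex x y)))"
    unfolding T_def by (subst integral_real2_iterated) (use cont_wT in \<open>simp_all add: complex_of_vec2_def vector_2\<close>)
  ultimately show ?thesis by simp
qed

section \<open>The area estimate and Bieberbach's inequality\<close>

lemma holomorphic_factor_at_0:
  fixes f :: "complex \<Rightarrow> complex"
  assumes f: "f holomorphic_on ball 0 R" and "0 < R"
  obtains k where "k holomorphic_on ball 0 R" "\<And>z. f z = f 0 + z * k z" "k 0 = deriv f 0"
proof
  define k where "k z = (if z = 0 then deriv f 0 else (f z - f 0) / (z - 0))" for z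
  show "k holomorphic_on ball 0 R"
    unfolding k_def by (rule pole_lemma_open) (use f in auto)
  show "f z = f 0 + z * k z" "k 0 = deriv f 0" for z
    by (simp_all add: k_def)
qed

text \<open>Cauchy's theorem for n turns around a circle: the integrand is, up to the factor \<i>, the derivative of
a primitive of K along the circle. Several turns are needed below, where an error term independent of n
is to be made negligible.\<close>
lemma integral_circle_zero:
  fixes K :: "complex \<Rightarrow> complex" and n :: nat
  assumes K: "K holomorphic_on ball 0 1" and s: "0 \<le> s" "s < 1"
  shows "((\<lambda>y. (of_real s * exp (\<i> * of_real y)) * K (of_real s * exp (\<i> * of_real y))) has_integral 0)
     {0..2 * pi * n}"
proof -
  obtain P where P: "\<And>z. z \<in> ball 0 1 \<Longrightarrow> (P has_field_derivative K z) (at z)"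
    using holomorphic_convex_primitive'[OF convex_ball open_ball K]
    by (metis at_within_open open_ball)
  define G where "G y = - \<i> * P (of_real s * exp (\<i> * y))" for y :: complex
  have in_ball: "of_real s * exp (\<i> * of_real y) \<in> ball (0::complex) 1" for y
    using s by (simp add: norm_mult)
  have "((\<lambda>y::real. G (of_real y)) has_vector_derivative
      (of_real s * exp (\<i> * of_real y)) * K (of_real s * exp (\<i> * of_real y))) (at y within A)" for y A
    unfolding G_def
    by (rule has_vector_derivative_real_field)
       (auto intro!: derivative_eq_intros DERIV_chain2[where f = P] P[OF in_ball] simp: mult_ac)
  then have "((\<lambda>y. (of_real s * exp (\<i> * of_real y)) * K (of_real s * exp (\<i> * of_real y))) has_integral
      (G (of_real (2 * pi * n)) - G (of_real 0))) {0..2 * pi * n}"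
    by (intro fundamental_theorem_of_calculus) auto
  moreover have "exp (\<i> * of_real (2 * pi * n)) = 1"
    using exp_integer_2pi[of "of_nat n"] by (simp add: mult_ac)
  ultimately show ?thesis by (simp add: G_def)
qed

text \<open>The first two terms of Parseval's identity. With f(z) = c + dz + z^2 k(z), dropping \<bar>z^2 k\<bar>^2 from the
expansion of \<bar>f\<bar>^2 leaves \<bar>c\<bar>^2 + \<bar>d\<bar>^2 s^2 plus cross terms. On the circle \<bar>z\<bar> = s the latter have the form
2 Re (z K(z)) with K holomorphic, because z times its conjugate is s^2, and so they integrate to 0.\<close>
lemma mean_square_on_circle_ge:
  fixes f :: "complex \<Rightarrow> complex" and n :: nat
  assumes f: "f holomorphic_on ball 0 1" and s: "0 \<le> s" "s < 1"
  shows "2 * pi * n * ((norm (f 0))\<^sup>2 + (norm (deriv f 0))\<^sup>2 * s\<^sup>2)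
    \<le> integral {0..2 * pi * n} (\<lambda>y. (norm (f (of_real s * exp (\<i> * of_real y))))\<^sup>2)"
proof -
  obtain k1 where k1: "k1 holomorphic_on ball 0 1" "\<And>z. f z = f 0 + z * k1 z" "k1 0 = deriv f 0"
    by (rule holomorphic_factor_at_0[OF f zero_less_one]) (rule that; assumption)
  obtain k where k: "k holomorphic_on ball 0 1" "\<And>z. k1 z = k1 0 + z * k z"
    by (rule holomorphic_factor_at_0[OF k1(1) zero_less_one]) (rule that; assumption)
  define c where "c = f 0"
  define d where "d = deriv f 0"
  have fz: "f z = c + d * z + z * z * k z" for z
    using k1(2)[of z] k1(3) k(2)[of z] by (simp add: c_def d_def algebra_simps)
  define K where "K z = cnj c * d + cnj c * z * k z + cnj d * (of_real s)\<^sup>2 * k z" for z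
  have K: "K holomorphic_on ball 0 1"
    unfolding K_def by (intro holomorphic_intros k)
  have sq: "(norm (a + b))\<^sup>2 = (norm a)\<^sup>2 + 2 * Re (cnj a * b) + (norm b)\<^sup>2" for a b :: complex
    unfolding cmod_power2 by (simp add: power2_eq_square algebra_simps)
  have pointwise: "(norm c)\<^sup>2 + (norm d)\<^sup>2 * s\<^sup>2 + 2 * Re (z * K z) \<le> (norm (f z))\<^sup>2" if z: "norm z = s" for z
  proof -
    have "(norm (f z))\<^sup>2 = (norm (c + d * z))\<^sup>2 + 2 * Re (cnj (c + d * z) * (z * z * k z)) + (norm (z * z * k z))\<^sup>2"
      unfolding fz by (rule sq)
    also have "(norm (c + d * z))\<^sup>2 = (norm c)\<^sup>2 + 2 * Re (cnj c * (d * z)) + (norm d)\<^sup>2 * s\<^sup>2"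
      by (simp only: sq norm_mult power_mult_distrib z)
    also have "cnj (c + d * z) * (z * z * k z) = cnj c * z * z * k z + cnj d * (z * cnj z) * z * k z"
      by (simp add: algebra_simps)
    also have "z * cnj z = (of_real s)\<^sup>2"
      using z by (simp add: complex_norm_square[symmetric])
    also have "(norm c)\<^sup>2 + 2 * Re (cnj c * (d * z)) + (norm d)\<^sup>2 * s\<^sup>2 + 
       2 * Re (cnj c * z * z * k z + cnj d * (of_real s)\<^sup>2 * z * k z) = (norm c)\<^sup>2 + (norm d)\<^sup>2 * s\<^sup>2 + 2 * Re (z * K z)"
    proof -
      have "z * K z = cnj c * (d * z) + (cnj c * z * z * k z + cnj d * (of_real s)\<^sup>2 * z * k z)"
        by (simp add: K_def algebra_simps)
      then show ?thesis by simp
    qed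
    finally show ?thesis by simp
  qed
  define e where "e y = of_real s * exp (\<i> * of_real y)" for y
  have e: "norm (e y) = s" for y using s by (simp add: e_def norm_mult)
  have "((\<lambda>y. e y * K (e y)) has_integral 0) {0..2 * pi * n}"
    unfolding e_def by (rule integral_circle_zero[OF K s])
  from has_integral_linear[OF this bounded_linear_Re]
  have "((\<lambda>y. Re (e y * K (e y))) has_integral 0) {0..2 * pi * n}"
    by (simp add: o_def)
  from has_integral_add[OF has_integral_const_real has_integral_mult_right[OF this, of 2]]
  have "((\<lambda>y. (norm c)\<^sup>2 + (norm d)\<^sup>2 * s\<^sup>2 + 2 * Re (e y * K (e y))) has_integral
      (2 * pi * n * ((norm c)\<^sup>2 + (norm d)\<^sup>2 * s\<^sup>2))) {0..2 * pi * n}"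
    by simp
  moreover have "(\<lambda>y. (norm (f (e y)))\<^sup>2) integrable_on {0..2 * pi * n}"
  proof (rule integrable_continuous_real, intro continuous_intros)
    show "continuous_on {0..2 * pi * n} (\<lambda>y. f (e y))"
    proof (rule continuous_on_compose2[OF holomorphic_on_imp_continuous_on[OF f]])
      show "continuous_on {0..2 * pi * real n} e" unfolding e_def by (intro continuous_intros)
    qed (use e s in auto)
  qed
  ultimately have "2 * pi * n * ((norm c)\<^sup>2 + (norm d)\<^sup>2 * s\<^sup>2) \<le>
     integral {0..2 * pi * n} (\<lambda>y. (norm (f (e y)))\<^sup>2)"
    using pointwise[OF e] by (intro has_integral_le[OF _ integrable_integral]) auto
  then show ?thesis by (simp add: c_def d_def e_def)
qed

text \<open>The minimum principle does not apply directly in the annulus, where nothing is known near the outer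
circle; univalence replaces it. The disc of radius \<mu> around 0 does not meet the image of the circle
\<bar>w\<bar> = \<epsilon>, so by connectedness it is covered by the image of the disc inside, and no point outside can
have a value in it.\<close>
lemma univalent_norm_ge_on_outside:
  fixes \<phi> :: "complex \<Rightarrow> complex"
  assumes \<phi>: "\<phi> holomorphic_on ball 0 1" "inj_on \<phi> (ball 0 1)" "\<phi> 0 = 0"
    and eps: "0 < \<epsilon>" "\<epsilon> < 1" and low: "\<And>w. norm w = \<epsilon> \<Longrightarrow> \<mu> \<le> norm (\<phi> w)"
    and z: "\<epsilon> \<le> norm z" "norm z < 1"
  shows "\<mu> \<le> norm (\<phi> z)"
proof (rule ccontr)
  assume less: "\<not> \<mu> \<le> norm (\<phi> z)"
  have sub: "ball 0 \<epsilon> \<subseteq> ball (0::complex) 1" "cball 0 \<epsilon> \<subseteq> ball (0::complex) 1" using eps by auto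
  have "open (\<phi> ` ball 0 \<epsilon>)"
    by (rule open_mapping_thm3[OF holomorphic_on_subset[OF \<phi>(1) sub(1)]])
       (use sub \<phi>(2) inj_on_subset in auto)
  moreover have "compact (\<phi> ` cball 0 \<epsilon>)"
    by (intro compact_continuous_image holomorphic_on_imp_continuous_on
        holomorphic_on_subset[OF \<phi>(1) sub(2)]) auto
  then have "open (- \<phi> ` cball 0 \<epsilon>)" by (simp add: compact_imp_closed open_Compl)
  moreover have "ball 0 \<mu> \<subseteq> \<phi> ` ball 0 \<epsilon> \<union> - \<phi> ` cball 0 \<epsilon>"
  proof
    fix w :: complex assume w: "w \<in> ball 0 \<mu>"
    have "w \<in> \<phi> ` ball 0 \<epsilon>" if "w \<in> \<phi> ` cball 0 \<epsilon>"
    proof -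
      obtain u where u: "w = \<phi> u" "norm u \<le> \<epsilon>" using \<open>w \<in> \<phi> ` cball 0 \<epsilon>\<close> by auto
      then have "norm u \<noteq> \<epsilon>" using low w by fastforce
      then show ?thesis using u by auto
    qed
    then show "w \<in> \<phi> ` ball 0 \<epsilon> \<union> - \<phi> ` cball 0 \<epsilon>" by blast
  qed
  moreover have "0 \<in> \<phi> ` ball 0 \<epsilon>"
    using \<phi>(3) eps by (metis centre_in_ball imageI)
  moreover have "0 \<in> ball (0::complex) \<mu>"
    using less norm_ge_zero[of "\<phi> z"] by (metis centre_in_ball not_le order_le_less_trans)
  moreover have "\<phi> z \<in> ball 0 \<mu>" using less by simp
  moreover have "\<phi> z \<notin> \<phi> ` ball 0 \<epsilon>"
  proof
    assume "\<phi> z \<in> \<phi> ` ball 0 \<epsilon>"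
    then obtain u where "\<phi> z = \<phi> u" "norm u < \<epsilon>" by auto
    then have "z = u" using \<phi>(2) z eps by (auto dest!: inj_onD)
    then show False using z \<open>norm u < \<epsilon>\<close> by simp
  qed
  moreover have "\<phi> ` ball 0 \<epsilon> \<inter> - \<phi> ` cball 0 \<epsilon> \<inter> ball 0 \<mu> = {}"
    using ball_subset_cball by fastforce
  ultimately show False
    using connectedD[OF connected_ball[of 0 \<mu>], of "\<phi> ` ball 0 \<epsilon>" "- \<phi> ` cball 0 \<epsilon>"]
    by blast
qed

lemma is_log_ratio_norm:
  assumes "is_log_ratio \<phi> L" "norm z < 1"
  shows "norm (\<phi> z) = norm z * exp (Re (L z))"
proof -
  have "\<phi> z = z * exp (L z)"
    using assms by (simp add: is_log_ratio_def mult.commute)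
  then show ?thesis by (simp add: norm_mult)
qed

lemma has_integral_exp_linear:
  fixes c :: real
  assumes "c \<noteq> 0" "a \<le> b"
  shows "((\<lambda>x. exp (c * x)) has_integral (exp (c * b) - exp (c * a)) / c) {a..b}"
proof -
  have "((\<lambda>x. exp (c * x) / c) has_vector_derivative exp (c * x)) (at x within {a..b})" for x
    unfolding has_real_derivative_iff_has_vector_derivative[symmetric]
    by (rule derivative_eq_intros refl | use assms in simp)+
  then show ?thesis
    using fundamental_theorem_of_calculus[OF assms(2), of "\<lambda>x. exp (c * x) / c" "\<lambda>x. exp (c * x)"]
    by (simp add: diff_divide_distrib)
qed

text \<open>The map \<zeta> \<mapsto> \<zeta> + L (exp \<zeta>) is log \<phi> in logarithmic coordinates. It inherits injectivity from \<phi>: equal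
values force equal exp \<zeta>, and then L cancels.\<close>
lemma log_coordinate_inj:
  assumes \<phi>: "\<phi> \<in> class_S" and L: "is_log_ratio \<phi> L"
  shows "inj_on (\<lambda>\<zeta>. \<zeta> + L (exp \<zeta>)) {\<zeta>. Re \<zeta> < 0}"
proof (rule inj_onI)
  fix \<zeta> \<xi> assume h: "\<zeta> \<in> {\<zeta>. Re \<zeta> < 0}" "\<xi> \<in> {\<zeta>. Re \<zeta> < 0}"
    and eq: "\<zeta> + L (exp \<zeta>) = \<xi> + L (exp \<xi>)"
  have in_disc: "exp \<zeta> \<in> unit_disc" "exp \<xi> \<in> unit_disc" using h by auto
  have "exp (L (exp \<zeta>)) * exp \<zeta> = exp (L (exp \<xi>)) * exp \<xi>"
    using eq by (metis exp_add add.commute)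
  then have "\<phi> (exp \<zeta>) = \<phi> (exp \<xi>)"
    using L in_disc by (simp add: is_log_ratio_def)
  then have "exp \<zeta> = exp \<xi>"
    using \<phi> in_disc by (auto simp: class_S_def dest: inj_onD)
  then show "\<zeta> = \<xi>" using eq by simp
qed

text \<open>The weighted area, with density exp (-2q Re), of the image under \<Lambda>(\<zeta>) = \<zeta> + L (exp \<zeta>) of the rectangle
x0 \<le> Re \<zeta> \<le> x1, 0 \<le> Im \<zeta> \<le> 2\<pi>n is estimated in two ways. From below, it is an integral over
circles of \<bar>\<Delta>\<bar>^2 with \<Delta> = (1 + z L') exp (-qL), so Parseval applies. From above, the image lies in
Re \<ge> m, and its imaginary parts stay in an interval of length 2\<pi>n + 2C, because \<Lambda> differs from the identity by a bounded
function. Dividing by n and letting n grow removes C. This is the area theorem for the power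
\<phi>^(-q) of \<phi>, in coordinates where that power is single-valued.\<close>
lemma prawitz_area_estimate:
  assumes \<phi>: "\<phi> \<in> class_S" and L: "is_log_ratio \<phi> L"
    and q: "0 < q" "q < 1"
    and x: "x0 \<le> x1" "x1 < 0"
    and m: "\<And>\<zeta>. x0 \<le> Re \<zeta> \<Longrightarrow> Re \<zeta> < 0 \<Longrightarrow> m \<le> Re (\<zeta> + L (exp \<zeta>))"
  shows "(exp (-2*q*x0) - exp (-2*q*x1)) / (2*q)
     + (1-q)\<^sup>2 * (norm (deriv L 0))\<^sup>2 * (exp ((2-2*q)*x1) - exp ((2-2*q)*x0)) / (2-2*q)
     \<le> exp (-2*q*m) / (2*q)" (is "?V \<le> ?W")
proof -
  define \<Lambda> where "\<Lambda> \<zeta> = \<zeta> + L (exp \<zeta>)" for \<zeta>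
  define \<Delta> where "\<Delta> z = (1 + z * deriv L z) * exp (- of_real q * L z)" for z
  define U where "U = {\<zeta>::complex. Re \<zeta> < 0}"
  have L_holo: "L holomorphic_on unit_disc" and L0: "L 0 = 0"
    using L by (auto simp: is_log_ratio_def)
  have U: "open U" by (simp add: U_def open_halfspace_Re_lt)
  have exp_U: "exp \<zeta> \<in> unit_disc" if "\<zeta> \<in> U" for \<zeta> using that by (simp add: U_def)
  have \<Lambda>_der: "(\<Lambda> has_field_derivative (1 + exp \<zeta> * deriv L (exp \<zeta>))) (at \<zeta>)" if "\<zeta> \<in> U" for \<zeta>
    unfolding \<Lambda>_def
    by (auto intro!: derivative_eq_intros DERIV_chain2[where f = L] holomorphic_derivI[OF L_holo open_ball exp_U[OF that]])
  have \<Lambda>_holo: "\<Lambda> holomorphic_on U"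
    using \<Lambda>_der U by (meson holomorphic_onI field_differentiable_at_within field_differentiable_def)
  have dL_holo: "deriv L holomorphic_on unit_disc"
    by (rule holomorphic_deriv[OF L_holo open_ball])
  have \<Delta>_holo: "\<Delta> holomorphic_on unit_disc"
    unfolding \<Delta>_def by (intro holomorphic_intros L_holo dL_holo)
  have \<Delta>0: "\<Delta> 0 = 1" by (simp add: \<Delta>_def L0)
  have \<Delta>1: "((\<lambda>z. 1 + z * deriv L z) has_field_derivative deriv L 0) (at 0)"
    by (rule derivative_eq_intros holomorphic_derivI[OF dL_holo open_ball] | simp)+
  have \<Delta>2: "((\<lambda>z. exp (- of_real q * L z)) has_field_derivative - of_real q * deriv L 0) (at 0)"
    by (rule derivative_eq_intros holomorphic_derivI[OF L_holo open_ball] | simp add: L0)+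
  have "(\<Delta> has_field_derivative (1 - of_real q) * deriv L 0) (at 0)"
    using DERIV_mult[OF \<Delta>1 \<Delta>2] unfolding \<Delta>_def by (simp add: L0 algebra_simps)
  then have \<Delta>0': "deriv \<Delta> 0 = (1 - of_real q) * deriv L 0"
    by (rule DERIV_imp_deriv)
  have d: "(norm (deriv \<Delta> 0))\<^sup>2 = (1-q)\<^sup>2 * (norm (deriv L 0))\<^sup>2"
  proof -
    have "norm (1 - complex_of_real q) = \<bar>1 - q\<bar>"
      by (metis norm_of_real of_real_1 of_real_diff)
    then show ?thesis by (simp add: \<Delta>0' norm_mult power_mult_distrib)
  qed
  have "cball 0 (exp x1) \<subseteq> unit_disc"
  proof
    fix z :: complex assume "z \<in> cball 0 (exp x1)"
    then have "norm z \<le> exp x1" by simp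
    also have "exp x1 < 1" using x by simp
    finally show "z \<in> unit_disc" by simp
  qed
  then have "compact (L ` cball 0 (exp x1))"
    by (intro compact_continuous_image holomorphic_on_imp_continuous_on
        holomorphic_on_subset[OF L_holo]) auto
  then have "bounded (L ` cball 0 (exp x1))" by (rule compact_imp_bounded)
  then obtain C where "C > 0" "\<forall>v\<in>L ` cball 0 (exp x1). norm v \<le> C"
    unfolding bounded_pos by blast
  then have C: "C > 0" "\<And>z. norm z \<le> exp x1 \<Longrightarrow> norm (L z) \<le> C"
    by simp_all
  define w :: "complex \<Rightarrow> real" where "w z = exp (-2*q*Re z)" for z
  have integrand: "(norm (deriv \<Lambda> (Complex x y)))\<^sup>2 * w (\<Lambda> (Complex x y))
      = exp (-2*q*x) * (norm (\<Delta> (of_real (exp x) * exp (\<i> * of_real y))))\<^sup>2" if "x < 0" for x y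
  proof -
    define \<zeta> where "\<zeta> = Complex x y"
    have "\<zeta> \<in> U" using that by (simp add: U_def \<zeta>_def)
    have e: "exp \<zeta> = of_real (exp x) * exp (\<i> * of_real y)"
      unfolding \<zeta>_def by (metis complex_eq exp_add exp_of_real complex.sel)
    have "w (\<Lambda> \<zeta>) = exp (-2*q*x) * exp (-2*q*Re (L (exp \<zeta>)))"
      by (simp add: w_def \<Lambda>_def \<zeta>_def exp_add[symmetric] algebra_simps)
    also have "exp (-2*q*Re (L (exp \<zeta>))) = (norm (exp (- of_real q * L (exp \<zeta>))))\<^sup>2"
      by (simp add: exp_double[symmetric])
    finally show ?thesis
      by (simp only: DERIV_imp_deriv[OF \<Lambda>_der[OF \<open>\<zeta> \<in> U\<close>]] \<zeta>_def[symmetric] e[symmetric])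
         (simp add: \<Delta>_def norm_mult power_mult_distrib)
  qed
  define I where "I n x = integral {0..2*pi*real n} (\<lambda>y. (norm (deriv \<Lambda> (Complex x y)))\<^sup>2 * w (\<Lambda> (Complex x y)))"
    for n x
  have I_ge: "2*pi*real n * (exp (-2*q*x) + (1-q)\<^sup>2 * (norm (deriv L 0))\<^sup>2 * exp ((2-2*q)*x)) \<le> I n x" if "x < 0" for n x
  proof -
    have "exp (-2*q*x) * (2*pi*real n * (1 + (1-q)\<^sup>2 * (norm (deriv L 0))\<^sup>2 * (exp x)\<^sup>2)) \<le> 
        exp (-2*q*x) * integral {0..2*pi*real n} (\<lambda>y. (norm (\<Delta> (of_real (exp x) * exp (\<i> * of_real y))))\<^sup>2)"
      using mean_square_on_circle_ge[OF \<Delta>_holo, of "exp x" n] that by (simp add: d \<Delta>0)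
    also have "\<dots> = I n x" 
      unfolding I_def integrand[OF that] by simp
    also have "(exp x)\<^sup>2 = exp (2*x)" by (simp add: exp_double)
    also have "exp (-2*q*x) * (2*pi*real n * (1 + (1-q)\<^sup>2 * (norm (deriv L 0))\<^sup>2 * exp (2*x)))
       = 2*pi*real n * (exp (-2*q*x) + (1-q)\<^sup>2 * (norm (deriv L 0))\<^sup>2 * (exp (-2*q*x) * exp (2*x)))"
      by (simp add: algebra_simps)
    also have "exp (-2*q*x) * exp (2*x) = exp ((2-2*q)*x)"
      by (simp add: exp_add[symmetric] algebra_simps)
    finally show ?thesis .
  qed
  have main: "2*pi*real n * ?V \<le> (2*pi*real n + 2*C) * ?W" for n
  proof -
    define S where "S = cbox (Complex x0 0) (Complex x1 (2*pi*real n))"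
    have S: "\<zeta> \<in> S \<longleftrightarrow> x0 \<le> Re \<zeta> \<and> Re \<zeta> \<le> x1 \<and> 0 \<le> Im \<zeta> \<and> Im \<zeta> \<le> 2*pi*real n" for \<zeta>
      by (auto simp: S_def in_cbox_complex_iff)
    have SU: "S \<subseteq> U" using S x by (auto simp: U_def)
    \<comment> \<open>Re \<Lambda> is at most x1 + C < C on the rectangle; the maximum makes the interval {m..X} nonempty in any case\<close>
    define X where "X = max m C"
    have img: "\<Lambda> ` S \<subseteq> cbox (Complex m (-C)) (Complex X (2*pi*real n + C))"
    proof (rule image_subsetI)
      fix \<zeta> assume \<zeta>: "\<zeta> \<in> S"
      have "norm (L (exp \<zeta>)) \<le> C" using \<zeta> S by (intro C) auto
      then have "\<bar>Re (L (exp \<zeta>))\<bar> \<le> C" "\<bar>Im (L (exp \<zeta>))\<bar> \<le> C"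
        by (meson abs_Re_le_cmod abs_Im_le_cmod order_trans)+
      moreover have "m \<le> Re (\<Lambda> \<zeta>)" unfolding \<Lambda>_def by (rule m) (use \<zeta> S x in auto)
      ultimately show "\<Lambda> \<zeta> \<in> cbox (Complex m (-C)) (Complex X (2*pi*real n + C))"
        using \<zeta> S x by (auto simp: \<Lambda>_def in_cbox_complex_iff X_def)
    qed
    have cont_w: "continuous_on UNIV w"
      unfolding w_def by (intro continuous_intros)
    have inj: "inj_on \<Lambda> S"
      using log_coordinate_inj[OF \<phi> L] SU unfolding \<Lambda>_def U_def by (rule inj_on_subset)
    have "integral {x0..x1} (I n) \<le> integral {m..X} (\<lambda>x. integral {-C..2*pi*real n + C} (\<lambda>y. w (Complex x y)))"
      using conformal_weighted_area_le[OF U \<Lambda>_holo SU[unfolded S_def] inj[unfolded S_def] img[unfolded S_def] cont_w]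
      unfolding I_def by (simp add: w_def)
    also have "\<dots> = (2*pi*real n + 2*C) * ((exp (-2*q*m) - exp (-2*q*X)) / (2*q))"
    proof -
      have inner: "integral {-C..2*pi*real n + C} (\<lambda>y. w (Complex x y)) = exp (-2*q*x) * (2*pi*real n + 2*C)" for x
        using C by (simp add: w_def)
      have "((\<lambda>x. exp (-2*q*x)) has_integral (exp (-2*q*X) - exp (-2*q*m)) / (-2*q)) {m..X}"
        by (rule has_integral_exp_linear) (use q in \<open>auto simp: X_def\<close>)
      then have "((\<lambda>x. exp (-2*q*x) * (2*pi*real n + 2*C)) has_integral 
          (exp (-2*q*X) - exp (-2*q*m)) / (-2*q) * (2*pi*real n + 2*C)) {m..X}"
        by (rule has_integral_mult_left)
      then have "integral {m..X} (\<lambda>x. integral {-C..2*pi*real n + C} (\<lambda>y. w (Complex x y)))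
          = (exp (-2*q*X) - exp (-2*q*m)) / (-2*q) * (2*pi*real n + 2*C)"
        unfolding inner by (rule integral_unique)
      moreover have "(exp (-2*q*X) - exp (-2*q*m)) / (-2*q) = (exp (-2*q*m) - exp (-2*q*X)) / (2*q)"
        using q by (simp add: field_simps)
      ultimately show ?thesis by (metis mult.commute)
    qed
    also have "\<dots> \<le> (2*pi*real n + 2*C) * ?W"
      using C q by (intro mult_left_mono divide_right_mono) auto
    finally have upper: "integral {x0..x1} (I n) \<le> (2*pi*real n + 2*C) * ?W" .
    define J where "J x = 2*pi*real n * (exp (-2*q*x) + (1-q)\<^sup>2 * (norm (deriv L 0))\<^sup>2 * exp ((2-2*q)*x))" for x
    have J_int: "(J has_integral (2*pi*real n * ?V)) {x0..x1}"
    proof -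
      have J1: "(J has_integral (2*pi*real n * ((exp (-2*q*x1) - exp (-2*q*x0)) / (-2*q)
         + (1-q)\<^sup>2 * (norm (deriv L 0))\<^sup>2 * ((exp ((2-2*q)*x1) - exp ((2-2*q)*x0)) / (2-2*q))))) {x0..x1}"
        unfolding J_def
        by (intro has_integral_mult_right has_integral_add has_integral_exp_linear) (use q x in auto)
      have J2: "(exp (-2*q*x1) - exp (-2*q*x0)) / (-2*q) = (exp (-2*q*x0) - exp (-2*q*x1)) / (2*q)"
        using q by (simp add: field_simps)
      show ?thesis
        using J1 unfolding J2 times_divide_eq_right .
    qed
    have "I n integrable_on {x0..x1}"
    proof (rule integrable_continuous_real)
      have sub: "(\<lambda>(x, y). Complex x y) ` ({x0..x1} \<times> cbox 0 (2*pi*real n)) \<subseteq> U"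
        using x by (auto simp: U_def)
      have cC: "continuous_on A (\<lambda>(x, y). Complex x y)" for A
        unfolding Complex_eq split_beta by (intro continuous_intros)
      have dh: "deriv \<Lambda> holomorphic_on U" by (rule holomorphic_deriv[OF \<Lambda>_holo U])
      have 1: "continuous_on ({x0..x1} \<times> cbox 0 (2*pi*real n)) (\<lambda>p. deriv \<Lambda> (case p of (x, y) \<Rightarrow> Complex x y))"
        by (rule continuous_on_compose2[OF holomorphic_on_imp_continuous_on[OF dh] cC sub])
      have 2: "continuous_on ({x0..x1} \<times> cbox 0 (2*pi*real n)) (\<lambda>p. \<Lambda> (case p of (x, y) \<Rightarrow> Complex x y))"
        by (rule continuous_on_compose2[OF holomorphic_on_imp_continuous_on[OF \<Lambda>_holo] cC sub])
      have 3: "continuous_on ({x0..x1} \<times> cbox 0 (2*pi*real n)) (\<lambda>p. w (\<Lambda> (case p of (x, y) \<Rightarrow> Complex x y)))"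
        by (rule continuous_on_compose2[OF cont_w 2]) auto
      have "continuous_on ({x0..x1} \<times> cbox 0 (2*pi*real n)) (\<lambda>(x, y). (norm (deriv \<Lambda> (Complex x y)))\<^sup>2 * w (\<Lambda> (Complex x y)))"
        using continuous_on_mult[OF continuous_on_power[OF continuous_on_norm[OF 1], of 2] 3] by (simp add: split_beta)
      then have "continuous_on {x0..x1} (\<lambda>x. integral (cbox 0 (2*pi*real n)) (\<lambda>y. (norm (deriv \<Lambda> (Complex x y)))\<^sup>2 * w (\<Lambda> (Complex x y))))"
        by (rule integral_continuous_on_param)
      then show "continuous_on {x0..x1} (I n)" by (simp add: I_def)
    qed
    then have "2*pi*real n * ?V \<le> integral {x0..x1} (I n)"
      using I_ge x by (intro has_integral_le[OF J_int integrable_integral]) (auto simp: J_def)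
    then show ?thesis using upper by linarith
  qed
  show ?thesis
  proof (rule ccontr)
    assume "\<not> ?V \<le> ?W"
    then have pos: "2*pi*(?V - ?W) > 0" by simp
    obtain n :: nat where "2*C*?W < of_nat n * (2*pi*(?V - ?W))"
      using reals_Archimedean3[OF pos] by blast
    then have "2*C*?W < 2*pi*real n * ?V - 2*pi*real n * ?W" by (simp only: right_diff_distrib mult_ac)
    moreover have "2*pi*real n * ?V \<le> 2*pi*real n * ?W + 2*C*?W"
      using main[of n] by (simp only: distrib_right)
    ultimately show False by linarith
  qed
qed

text \<open>Bieberbach's inequality: L'(0) is the second coefficient of \<phi>. In the area estimate let x0 tend to
-\<infinity> with m = x0 - C exp x0. The two divergent terms exp (-2q x0) and exp (-2q m) differ by
a quantity of order exp ((1 - 2q) x0), which vanishes in the limit precisely for q < 1/2. What remains,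
after x1 \<rightarrow> 0, is q (1 - q) \<bar>L'(0)\<bar>^2 \<le> 1, and q \<rightarrow> 1/2 gives the sharp constant.\<close>
lemma bieberbach_log_ratio:
  assumes \<phi>: "\<phi> \<in> class_S" and L: "is_log_ratio \<phi> L"
  shows "norm (deriv L 0) \<le> 2"
proof -
  have L_holo: "L holomorphic_on unit_disc" and L0: "L 0 = 0"
    using L by (auto simp: is_log_ratio_def)
  have \<phi>': "\<phi> holomorphic_on unit_disc" "inj_on \<phi> unit_disc" "\<phi> 0 = 0"
    using \<phi> by (auto simp: class_S_def class_A_def)
  obtain k where k: "k holomorphic_on ball 0 1" "\<And>z. L z = L 0 + z * k z"
    by (rule holomorphic_factor_at_0[OF L_holo zero_less_one]) (rule that; assumption)
  have "continuous_on (cball 0 (1/2)) k"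
    by (rule holomorphic_on_imp_continuous_on[OF holomorphic_on_subset[OF k(1)]]) auto
  then have "bounded (k ` cball 0 (1/2))"
    by (intro compact_imp_bounded compact_continuous_image) auto
  then obtain C where C: "C > 0" "\<And>z. norm z \<le> 1/2 \<Longrightarrow> norm (k z) \<le> C"
    unfolding bounded_pos by auto
  have L_le: "norm (L z) \<le> C * norm z" if "norm z \<le> 1/2" for z
    using mult_right_mono[OF C(2)[OF that] norm_ge_zero[of z]] k(2)[of z] L0
    by (simp add: norm_mult mult.commute)
  have m: "x0 - C * exp x0 \<le> Re (\<zeta> + L (exp \<zeta>))"
    if x0: "exp x0 \<le> 1/2" and \<zeta>: "x0 \<le> Re \<zeta>" "Re \<zeta> < 0" for x0 \<zeta>
  proof -
    have "exp (x0 - C * exp x0) \<le> norm (\<phi> (exp \<zeta>))"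
    proof (rule univalent_norm_ge_on_outside[OF \<phi>'])
      fix w :: complex assume w: "norm w = exp x0"
      then have "norm (L w) \<le> C * exp x0" using L_le[of w] x0 by simp
      then have "- (C * exp x0) \<le> Re (L w)" using abs_Re_le_cmod[of "L w"] by linarith
      then have "exp x0 * exp (- (C * exp x0)) \<le> norm w * exp (Re (L w))" using w by simp
      also have "\<dots> = norm (\<phi> w)"
        using is_log_ratio_norm[OF L, of w] w x0 by linarith
      finally show "exp (x0 - C * exp x0) \<le> norm (\<phi> w)" by (simp add: exp_diff exp_minus field_simps)
    qed (use x0 \<zeta> in \<open>auto simp: le_less_trans[of "exp x0" "1/2" 1]\<close>)
    also have "\<dots> = exp (Re (\<zeta> + L (exp \<zeta>)))"
      using is_log_ratio_norm[OF L, of "exp \<zeta>"] \<zeta> by (simp add: exp_add)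
    finally show ?thesis by simp
  qed
  define a where "a = norm (deriv L 0)"
  have step1: "(1-q)\<^sup>2 * a\<^sup>2 * exp ((2-2*q)*x1) / (2-2*q) - exp (-2*q*x1) / (2*q) \<le> 0"
    if q: "0 < q" "q < 1/2" and x1: "x1 < 0" for q x1 :: real
  proof (rule tendsto_le[OF _ _ tendsto_const])
    have "((\<lambda>x. exp (-2*q*x) * (exp (2*q*C*exp x) - 1)) \<longlongrightarrow> 0) at_bot"
      using q C(1) by real_asymp
    then have "((\<lambda>x. exp (-2*q*x) * (exp (2*q*C*exp x) - 1) / (2*q)) \<longlongrightarrow> 0 / (2*q)) at_bot"
      by (intro tendsto_divide tendsto_const) (use q in auto)
    then show "((\<lambda>x. exp (-2*q*x) * (exp (2*q*C*exp x) - 1) / (2*q) + 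
       (1-q)\<^sup>2 * a\<^sup>2 * exp ((2-2*q)*x) / (2-2*q)) \<longlongrightarrow> 0) at_bot"
    proof -
      assume lim1: "((\<lambda>x. exp (-2*q*x) * (exp (2*q*C*exp x) - 1) / (2*q)) \<longlongrightarrow> 0 / (2*q)) at_bot"
      have "((\<lambda>x. exp ((2-2*q)*x)) \<longlongrightarrow> 0) at_bot" using q by real_asymp
      from tendsto_add[OF lim1 tendsto_mult_right_zero[OF this, of "(1-q)\<^sup>2 * a\<^sup>2 / (2-2*q)"]]
      show ?thesis by simp
    qed
    show "eventually (\<lambda>x. (1-q)\<^sup>2 * a\<^sup>2 * exp ((2-2*q)*x1) / (2-2*q) - exp (-2*q*x1) / (2*q) \<le>
       exp (-2*q*x) * (exp (2*q*C*exp x) - 1) / (2*q) + 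
       (1-q)\<^sup>2 * a\<^sup>2 * exp ((2-2*q)*x) / (2-2*q)) at_bot"
      using eventually_le_at_bot[of "min x1 (ln (1/2))"]
    proof eventually_elim
      case (elim x)
      then have "x \<le> ln (1/2)" by simp
      then have "exp x \<le> exp (ln (1/2))" by (simp only: exp_le_cancel_iff)
      then have "exp x \<le> 1/2" by simp
      have "(exp (-2*q*x) - exp (-2*q*x1)) / (2*q)
         + (1-q)\<^sup>2 * a\<^sup>2 * (exp ((2-2*q)*x1) - exp ((2-2*q)*x)) / (2-2*q)
         \<le> exp (-2*q*(x - C * exp x)) / (2*q)"
        unfolding a_def
        by (rule prawitz_area_estimate[OF \<phi> L]) (use q x1 elim m[OF \<open>exp x \<le> 1/2\<close>] in auto)
      also have "exp (-2*q*(x - C * exp x)) = exp (-2*q*x) * exp (2*q*C*exp x)"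
        by (simp add: exp_add[symmetric] algebra_simps)
      finally show ?case by (simp add: diff_divide_distrib right_diff_distrib)
    qed
  qed simp_all
  have step2: "(1-q) * a\<^sup>2 * q \<le> 1" if q: "0 < q" "q < 1/2" for q :: real
  proof -
    have "(1-q)\<^sup>2 * a\<^sup>2 * exp ((2-2*q)*0) / (2-2*q) - exp (-2*q*0) / (2*q) \<le> 0"
    proof (rule tendsto_upperbound)
      show "((\<lambda>x. (1-q)\<^sup>2 * a\<^sup>2 * exp ((2-2*q)*x) / (2-2*q) - exp (-2*q*x) / (2*q)) \<longlongrightarrow> 
        (1-q)\<^sup>2 * a\<^sup>2 * exp ((2-2*q)*0) / (2-2*q) - exp (-2*q*0) / (2*q)) (at_left 0)"
        by (intro tendsto_intros) (use q in auto)
      show "eventually (\<lambda>x. (1-q)\<^sup>2 * a\<^sup>2 * exp ((2-2*q)*x) / (2-2*q) - exp (-2*q*x) / (2*q) \<le> 0) (at_left 0)"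
        using step1[OF q] by (auto simp: eventually_at_left_field intro: exI[of _ "-1"])
    qed simp
    then have h1: "(1-q)\<^sup>2 * a\<^sup>2 / (2*(1-q)) \<le> 1 / (2*q)" by simp
    have h2: "(1-q)\<^sup>2 * a\<^sup>2 / (2*(1-q)) = (1-q) * a\<^sup>2 / 2"
      using q by (simp add: power2_eq_square field_simps)
    from h1[unfolded h2] have "(1-q) * a\<^sup>2 / 2 * (2*q) \<le> 1" using q by (simp only: pos_le_divide_eq)
    then show ?thesis by simp
  qed
  have "(1-1/2) * a\<^sup>2 * (1/2) \<le> 1"
  proof (rule tendsto_upperbound)
    show "((\<lambda>q. (1-q) * a\<^sup>2 * q) \<longlongrightarrow> (1-1/2) * a\<^sup>2 * (1/2)) (at_left (1/2))"
      by (intro tendsto_intros)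
    show "eventually (\<lambda>q. (1-q) * a\<^sup>2 * q \<le> 1) (at_left (1/2))"
      using step2 by (auto simp: eventually_at_left_field intro: exI[of _ 0])
  qed simp
  then have "a\<^sup>2 \<le> 2\<^sup>2" by simp
  then show ?thesis unfolding a_def by (rule power2_le_imp_le) simp
qed

text \<open>Bieberbach's inequality without normalization: F = F(0) + F'(0) z exp L, whose second derivative at 0
is 2 F'(0) L'(0).\<close>
theorem bieberbach_second_derivative:
  fixes F :: "complex \<Rightarrow> complex"
  assumes F: "F holomorphic_on unit_disc" "inj_on F unit_disc"
  shows "norm (deriv (deriv F) 0) \<le> 4 * norm (deriv F 0)"
proof -
  define A where "A = deriv F 0"
  have A: "A \<noteq> 0"
    unfolding A_def using holomorphic_injective_imp_regular[OF F(1) open_ball F(2)] by simp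
  define \<phi> where "\<phi> z = (F z - F 0) / A" for z
  have "(\<phi> has_field_derivative A / A) (at 0)"
    unfolding \<phi>_def
    by (rule derivative_eq_intros holomorphic_derivI[OF F(1) open_ball] refl | use A in \<open>simp add: A_def\<close>)+
  then have "deriv \<phi> 0 = 1" using A by (simp add: DERIV_imp_deriv)
  moreover have "\<phi> holomorphic_on unit_disc" unfolding \<phi>_def using A by (intro holomorphic_intros F) auto
  moreover have "inj_on \<phi> unit_disc" using F(2) A by (auto simp: \<phi>_def inj_on_def)
  ultimately have \<phi>: "\<phi> \<in> class_S" by (simp add: class_S_def class_A_def \<phi>_def)
  then obtain L where L: "is_log_ratio \<phi> L" using is_log_ratio_exists by blast
  have L_holo: "L holomorphic_on unit_disc" and L0: "L 0 = 0" 
    and exp_L: "\<And>z. z \<in> unit_disc \<Longrightarrow> exp (L z) * z = \<phi> z"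
    using L by (auto simp: is_log_ratio_def)
  have dL_holo: "deriv L holomorphic_on unit_disc"
    by (rule holomorphic_deriv[OF L_holo open_ball])
  have F_eq: "F 0 + A * (exp (L z) * z) = F z" if "z \<in> unit_disc" for z
    using exp_L[OF that] A by (simp add: \<phi>_def)
  define G where "G z = A * (exp (L z) * (1 + z * deriv L z))" for z
  have F': "deriv F z = G z" if z: "z \<in> unit_disc" for z
  proof -
    have "((\<lambda>z. F 0 + A * (exp (L z) * z)) has_field_derivative G z) (at z)"
      unfolding G_def
      by (rule derivative_eq_intros holomorphic_derivI[OF L_holo open_ball z] refl | simp add: algebra_simps)+
    then have "(F has_field_derivative G z) (at z)"
      by (rule has_field_derivative_transform_within_open[OF _ open_ball z F_eq])
    then show ?thesis by (rule DERIV_imp_deriv)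
  qed
  have "(G has_field_derivative 2 * A * deriv L 0) (at 0)"
    unfolding G_def
    by (rule derivative_eq_intros holomorphic_derivI[OF L_holo open_ball] 
       holomorphic_derivI[OF dL_holo open_ball] refl | simp add: L0)+
  then have "(deriv F has_field_derivative 2 * A * deriv L 0) (at 0)"
    by (rule has_field_derivative_transform_within_open[OF _ open_ball[of 0 1]]) (simp_all add: F')
  then have "deriv (deriv F) 0 = 2 * A * deriv L 0" by (rule DERIV_imp_deriv)
  then show ?thesis
    using bieberbach_log_ratio[OF \<phi> L] mult_left_mono[OF bieberbach_log_ratio[OF \<phi> L], of "2 * norm A"]
    by (simp add: norm_mult A_def)
qed

text \<open>With r = \<bar>z\<bar>, the function u \<mapsto> 1 / (F(z) - F(ru)) is univalent on the disc, since F does not take the value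
F(z) on the smaller disc. Bieberbach's inequality for it involves F''(0), which Bieberbach's
inequality for F removes.\<close>
lemma univalent_difference_lower_bound:
  fixes F :: "complex \<Rightarrow> complex"
  assumes F: "F holomorphic_on unit_disc" "inj_on F unit_disc" and z: "z \<in> unit_disc"
  shows "norm z * norm (deriv F 0) \<le> (2 + 2 * norm z) * norm (F z - F 0)"
proof (cases "z = 0")
  case False
  define r where "r = norm z"
  have r: "0 < r" "r < 1" using z False by (auto simp: r_def)
  define W where "W = F z - F 0"
  have W: "W \<noteq> 0" using F(2) z False by (auto simp: W_def dest: inj_onD)
  define A where "A = deriv F 0"
  define B where "B = deriv (deriv F) 0"
  have A: "A \<noteq> 0"
    unfolding A_def using holomorphic_injective_imp_regular[OF F(1) open_ball F(2)] by simp
  have dF_holo: "deriv F holomorphic_on unit_disc" by (rule holomorphic_deriv[OF F(1) open_ball])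
  have ru: "norm (of_real r * u) < r" if "u \<in> unit_disc" for u :: complex
    using that r by (simp add: norm_mult)
  then have ru': "of_real r * u \<in> unit_disc" if "u \<in> unit_disc" for u :: complex
    using that r by (force intro: less_trans)
  have nz: "F z - F (of_real r * u) \<noteq> 0" if "u \<in> unit_disc" for u
    using inj_onD[OF F(2) _ z ru'[OF that]] ru[OF that] by (auto simp: r_def)
  define T where "T u = 1 / (F z - F (of_real r * u))" for u
  define T' where "T' u = of_real r * deriv F (of_real r * u) / (F z - F (of_real r * u))\<^sup>2" for u
  have T_der: "(T has_field_derivative T' u) (at u)" if u: "u \<in> unit_disc" for u
  proof -
    have "((\<lambda>u. F (of_real r * u)) has_field_derivative deriv F (of_real r * u) * of_real r) (at u)"
      by (rule DERIV_chain2[OF holomorphic_derivI[OF F(1) open_ball ru'[OF u]] DERIV_cmult_Id])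
    then show ?thesis
      unfolding T_def T'_def
      by - (rule derivative_eq_intros nz[OF u] refl | assumption | simp add: power2_eq_square)+
  qed
  have T'_der: "(T' has_field_derivative (of_real r)\<^sup>2 * (B * W + 2 * A\<^sup>2) / W ^ 3) (at 0)"
  proof -
    have "((\<lambda>u. deriv F (of_real r * u)) has_field_derivative B * of_real r) (at 0)"
      unfolding B_def
      by (rule DERIV_chain2[OF _ DERIV_cmult_Id]) (simp add: holomorphic_derivI[OF dF_holo open_ball])
    moreover have "((\<lambda>u. F (of_real r * u)) has_field_derivative A * of_real r) (at 0)"
      unfolding A_def
      by (rule DERIV_chain2[OF _ DERIV_cmult_Id]) (simp add: holomorphic_derivI[OF F(1) open_ball])
    ultimately show ?thesis
      unfolding T'_def 
      by - (rule derivative_eq_intros refl | assumption | 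
         use W in \<open>simp add: W_def[symmetric] A_def[symmetric] field_simps power2_eq_square power3_eq_cube\<close>)+
  qed
  have T_holo: "T holomorphic_on unit_disc"
    using T_der by (meson holomorphic_onI field_differentiable_at_within field_differentiable_def)
  have T_inj: "inj_on T unit_disc"
  proof (rule inj_onI)
    fix u v assume uv: "u \<in> unit_disc" "v \<in> unit_disc" "T u = T v"
    then have "F (of_real r * u) = F (of_real r * v)"
      using nz by (simp add: T_def)
    then have "of_real r * u = of_real r * v"
      using F(2) ru' uv by (meson inj_onD)
    then show "u = v" using r by simp
  qed
  have dT: "deriv T u = T' u" if "u \<in> unit_disc" for u by (rule DERIV_imp_deriv[OF T_der[OF that]])
  have "(deriv T has_field_derivative (of_real r)\<^sup>2 * (B * W + 2 * A\<^sup>2) / W ^ 3) (at 0)"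
    by (rule has_field_derivative_transform_within_open[OF T'_der open_ball[of 0 1]]) (simp_all add: dT)
  then have "deriv (deriv T) 0 = (of_real r)\<^sup>2 * (B * W + 2 * A\<^sup>2) / W ^ 3" by (rule DERIV_imp_deriv)
  moreover have "deriv T 0 = of_real r * A / W\<^sup>2" by (simp add: dT T'_def A_def W_def)
  ultimately have "r\<^sup>2 * norm (B * W + 2 * A\<^sup>2) / norm W ^ 3 \<le> 4 * (r * norm A / (norm W)\<^sup>2)"
    using bieberbach_second_derivative[OF T_holo T_inj] r
    by (simp add: norm_mult norm_divide norm_power)
  then have "r * norm (B * W + 2 * A\<^sup>2) \<le> 4 * norm A * norm W"
    using r W by (simp add: field_simps power2_eq_square power3_eq_cube)
  moreover have "2 * (norm A)\<^sup>2 \<le> norm (B * W + 2 * A\<^sup>2) + norm B * norm W"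
    using norm_triangle_ineq4[of "B * W + 2 * A\<^sup>2" "B * W"] by (simp add: norm_mult norm_power)
  moreover have "norm B \<le> 4 * norm A" unfolding A_def B_def by (rule bieberbach_second_derivative[OF F])
  then have "r * (norm B * norm W) \<le> r * (4 * norm A * norm W)"
    using r by (intro mult_left_mono mult_right_mono) auto
  ultimately have "r * (2 * (norm A)\<^sup>2) \<le> 4 * norm A * norm W + r * (4 * norm A * norm W)"
    using r mult_left_mono[of "2 * (norm A)\<^sup>2" "norm (B * W + 2 * A\<^sup>2) + norm B * norm W" r]
    unfolding distrib_left by linarith
  then have "norm A * (r * norm A) \<le> norm A * ((2 + 2 * r) * norm W)"
    by (simp add: algebra_simps power2_eq_square)
  then show ?thesis using A by (simp add: A_def W_def r_def)
qed simp

section \<open>The logarithmic derivative of a univalent function\<close>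

text \<open>Precompose \<phi> with the automorphism of the disc that sends 0 to z and -z to 0, and compare the values
at 0 and -z. The factor 1 - \<bar>z\<bar>^2 is the derivative of the automorphism at 0.\<close>
lemma univalent_log_derivative_bound:
  assumes \<phi>: "\<phi> holomorphic_on unit_disc" "inj_on \<phi> unit_disc" "\<phi> 0 = 0" and z: "z \<in> unit_disc"
  shows "(1 - (norm z)\<^sup>2) * norm (z * deriv \<phi> z) \<le> (2 + 2 * norm z) * norm (\<phi> z)"
proof -
  define M where "M = Moebius_function 0 (-z)"
  have M_holo: "M holomorphic_on unit_disc"
    unfolding M_def using z by (intro Moebius_function_holomorphic) simp
  have M_in: "M u \<in> unit_disc" if "u \<in> unit_disc" for u
    using Moebius_function_norm_lt_1[of "-z" u 0] z that by (simp add: M_def)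
  have M_inv: "Moebius_function 0 z (M u) = u" if "u \<in> unit_disc" for u
    unfolding M_def using z that by (intro Moebius_function_compose) auto
  have M0: "M 0 = z" by (simp add: M_def Moebius_function_of_zero)
  have Mz: "M (-z) = 0" by (simp add: M_def Moebius_function_eq_zero)
  define H where "H u = \<phi> (M u)" for u
  have H_holo: "H holomorphic_on unit_disc"
    using holomorphic_on_compose_gen[OF M_holo \<phi>(1)] M_in by (auto simp: H_def[abs_def] o_def image_subset_iff)
  have H_inj: "inj_on H unit_disc"
  proof (rule inj_onI)
    fix u v assume uv: "u \<in> unit_disc" "v \<in> unit_disc" "H u = H v"
    then have "M u = M v" using \<phi>(2) M_in unfolding H_def by (meson inj_onD)
    then show "u = v" using M_inv uv by metis
  qed
  have "(M has_field_derivative (1 - z * cnj z)) (at 0)"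
    unfolding M_def Moebius_function_simple
    by (rule derivative_eq_intros refl | simp)+
  then have "(H has_field_derivative deriv \<phi> z * (1 - z * cnj z)) (at 0)"
    unfolding H_def using holomorphic_derivI[OF \<phi>(1) open_ball z]
    by (intro DERIV_chain2[where f = \<phi>]) (simp_all add: M0)
  then have "deriv H 0 = deriv \<phi> z * (1 - z * cnj z)" by (rule DERIV_imp_deriv)
  moreover have "1 - z * cnj z = of_real (1 - (norm z)\<^sup>2)"
    by (simp add: complex_norm_square[symmetric])
  moreover have "(norm z)\<^sup>2 < 1" using z by (simp add: abs_square_less_1)
  ultimately have "norm (deriv H 0) = norm (deriv \<phi> z) * (1 - (norm z)\<^sup>2)"
    by (simp only: norm_mult norm_of_real)
  then show ?thesis
    using univalent_difference_lower_bound[OF H_holo H_inj, of "-z"] z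
    by (simp add: H_def Mz M0 \<phi>(3) norm_mult mult_ac)
qed

text \<open>Since z L' = z \<phi>'/\<phi> - 1, the previous bound gives 2 + 2r + (1 - r^2) = 4 - (1 - r)^2 with r = \<bar>z\<bar>.\<close>
lemma log_ratio_derivative_bound:
  assumes \<phi>: "\<phi> \<in> class_S" and L: "is_log_ratio \<phi> L" and z: "z \<in> unit_disc"
  shows "(1 - (norm z)\<^sup>2) * norm (z * deriv L z) \<le> 4"
proof (cases "z = 0")
  case False
  have \<phi>': "\<phi> holomorphic_on unit_disc" "inj_on \<phi> unit_disc" "\<phi> 0 = 0"
    using \<phi> by (auto simp: class_S_def class_A_def)
  have L_holo: "L holomorphic_on unit_disc" 
    and exp_L: "\<And>z. z \<in> unit_disc \<Longrightarrow> exp (L z) * z = \<phi> z"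
    using L by (auto simp: is_log_ratio_def)
  have "((\<lambda>z. exp (L z) * z) has_field_derivative exp (L z) * (1 + z * deriv L z)) (at z)"
    by (rule derivative_eq_intros holomorphic_derivI[OF L_holo open_ball z] refl | simp add: algebra_simps)+
  then have "(\<phi> has_field_derivative exp (L z) * (1 + z * deriv L z)) (at z)"
    by (rule has_field_derivative_transform_within_open[OF _ open_ball z exp_L])
  then have "z * deriv \<phi> z = \<phi> z * (1 + z * deriv L z)"
    using exp_L[OF z] by (simp add: DERIV_imp_deriv mult.commute)
  moreover have nz: "\<phi> z \<noteq> 0" using exp_L[OF z] False by (metis exp_not_eq_zero mult_eq_0_iff)
  ultimately have le: "(1 - (norm z)\<^sup>2) * norm (1 + z * deriv L z) \<le> 2 + 2 * norm z"
    using univalent_log_derivative_bound[OF \<phi>' z] by (simp add: norm_mult mult.left_commute)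
  have pos: "0 \<le> 1 - (norm z)\<^sup>2" using z by (simp add: abs_square_le_1)
  have "norm (z * deriv L z) \<le> norm (1 + z * deriv L z) + 1"
    using norm_triangle_ineq4[of "1 + z * deriv L z" 1] by simp
  then have "(1 - (norm z)\<^sup>2) * norm (z * deriv L z) \<le> (1 - (norm z)\<^sup>2) * (norm (1 + z * deriv L z) + 1)"
    using pos by (rule mult_left_mono)
  also have "\<dots> \<le> 2 + 2 * norm z + (1 - (norm z)\<^sup>2)" using le by (simp add: distrib_left)
  also have "\<dots> = 4 - (1 - norm z)\<^sup>2" by (simp add: power2_eq_square algebra_simps)
  also have "\<dots> \<le> 4" by simp
  finally show ?thesis .
qed simp

section \<open>Univalence of the integral transform\<close>

lemma C_transform_has_derivative:
  assumes "C_integrand \<alpha> \<beta> \<phi> holomorphic_on unit_disc" and "z \<in> unit_disc"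
  shows "(C_transform \<alpha> \<beta> \<phi> has_field_derivative C_integrand \<alpha> \<beta> \<phi> z) (at z)"
proof -
  obtain P where P: "\<And>z. z \<in> unit_disc \<Longrightarrow> (P has_field_derivative C_integrand \<alpha> \<beta> \<phi> z) (at z)"
    using holomorphic_convex_primitive'[OF convex_ball open_ball assms(1)]
    by (metis at_within_open open_ball)
  have eq: "P u - P 0 = C_transform \<alpha> \<beta> \<phi> u" if u: "u \<in> unit_disc" for u
  proof -
    have "closed_segment 0 u \<subseteq> unit_disc"
      using u by (intro closed_segment_subset) auto
    then have "(C_integrand \<alpha> \<beta> \<phi> has_contour_integral (P u - P 0)) (linepath 0 u)"
      using contour_integral_primitive[of unit_disc P "C_integrand \<alpha> \<beta> \<phi>" "linepath 0 u"] P
      by (auto intro: has_field_derivative_at_within)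
    then show ?thesis unfolding C_transform_def by (simp add: contour_integral_unique)
  qed
  have "((\<lambda>u. P u - P 0) has_field_derivative C_integrand \<alpha> \<beta> \<phi> z) (at z)"
    using DERIV_diff[OF P[OF assms(2)] DERIV_const] by simp
  then show ?thesis
    by (rule has_field_derivative_transform_within_open[OF _ open_ball assms(2) eq])
qed

theorem theorem3p1:
  fixes \<alpha> \<beta> :: complex and \<phi> :: "complex \<Rightarrow> complex"
  assumes "\<phi> \<in> class_S"
    and "norm \<alpha> \<le> 1 / (2 * (2 + norm \<beta>))"
  shows "C_transform \<alpha> \<beta> \<phi> \<in> class_S"
proof -
  \<comment> \<open>Becker's condition is checked for f = C_transform, with f'' = f' \<alpha> (L' + \<beta> / (1 - z))\<close>
  define L where "L = log_ratio \<phi>"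
  have L: "is_log_ratio \<phi> L"
    unfolding L_def log_ratio_def using is_log_ratio_exists[OF assms(1)] by (rule someI_ex)
  have L_holo: "L holomorphic_on unit_disc" and L0: "L 0 = 0"
    using L by (auto simp: is_log_ratio_def)
  define f where "f = C_transform \<alpha> \<beta> \<phi>"
  define k where "k = C_integrand \<alpha> \<beta> \<phi>"
  have re: "0 < Re (1 - z)" if "z \<in> unit_disc" for z
    using that complex_Re_le_cmod[of z] by simp
  have k_der: "(k has_field_derivative k z * \<alpha> * (deriv L z + \<beta> / (1 - z))) (at z)" if z: "z \<in> unit_disc" for z
  proof -
    have nz: "1 - z \<noteq> 0" "1 - z \<notin> \<real>\<^sub>\<le>\<^sub>0" 
      using re[OF z] by (auto simp: complex_nonpos_Reals_iff)
    have "((\<lambda>z. exp (\<alpha> * L z)) has_field_derivative exp (\<alpha> * L z) * (\<alpha> * deriv L z)) (at z)"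
      by (rule derivative_eq_intros holomorphic_derivI[OF L_holo open_ball z] refl | simp)+
    moreover have "((\<lambda>z. (1 - z) powr (- (\<alpha> * \<beta>))) has_field_derivative
       (1 - z) powr (- (\<alpha> * \<beta>)) * (\<alpha> * \<beta> / (1 - z))) (at z)"
      using nz by (auto intro!: derivative_eq_intros simp: powr_diff field_simps)
    ultimately show ?thesis
      unfolding k_def C_integrand_def L_def[symmetric]
      by (rule DERIV_mult[THEN DERIV_cong]) (simp add: algebra_simps)
  qed
  then have k_holo: "k holomorphic_on unit_disc"
    by (meson holomorphic_onI field_differentiable_at_within field_differentiable_def)
  have f_der: "(f has_field_derivative k z) (at z)" if "z \<in> unit_disc" for z
    using C_transform_has_derivative[OF _ that] k_holo unfolding f_def k_def by blast
  then have f_holo: "f holomorphic_on unit_disc"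
    by (meson holomorphic_onI field_differentiable_at_within field_differentiable_def)
  have df: "deriv f z = k z" if "z \<in> unit_disc" for z by (rule DERIV_imp_deriv[OF f_der[OF that]])
  have ddf: "deriv (deriv f) z = k z * \<alpha> * (deriv L z + \<beta> / (1 - z))" if "z \<in> unit_disc" for z
    by (rule DERIV_imp_deriv, rule has_field_derivative_transform_within_open[OF k_der[OF that] open_ball that])
       (simp add: df)
  have k_nz: "k z \<noteq> 0" if "z \<in> unit_disc" for z
    using re[OF that] by (auto simp: k_def C_integrand_def powr_def)
  have "inj_on f unit_disc"
  proof (rule becker_criterion[OF f_holo])
    fix z :: complex assume z: "z \<in> unit_disc"
    show "deriv f z \<noteq> 0" using k_nz[OF z] df[OF z] by simp
    define r where "r = norm z"
    have r: "0 \<le> r" "r < 1" using z by (auto simp: r_def)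
    have r2: "0 \<le> 1 - r\<^sup>2" using r by (simp add: abs_square_le_1)
    have A: "(1 - r\<^sup>2) * norm (z * deriv L z) \<le> 4"
      unfolding r_def by (rule log_ratio_derivative_bound[OF assms(1) L z])
    have "1 - r \<le> norm (1 - z)" using norm_triangle_ineq2[of 1 z] by (simp add: r_def)
    moreover from this have "0 < norm (1 - z)" using r by linarith
    ultimately have "norm \<beta> / norm (1 - z) \<le> norm \<beta> / (1 - r)"
      using r by (intro divide_left_mono mult_pos_pos norm_ge_zero) simp_all
    from mult_left_mono[OF this r(1)]
    have "norm (z * (\<beta> / (1 - z))) \<le> r * (norm \<beta> / (1 - r))"
      by (simp add: norm_mult norm_divide r_def)
    then have "(1 - r\<^sup>2) * norm (z * (\<beta> / (1 - z))) \<le> (1 - r\<^sup>2) * (r * (norm \<beta> / (1 - r)))"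
      using r2 by (rule mult_left_mono)
    also have "\<dots> = ((1 + r) * r) * norm \<beta>"
      using r by (simp add: field_simps power2_eq_square)
    also have "\<dots> \<le> 2 * norm \<beta>"
      using r mult_mono[of "1 + r" 2 r 1] by (intro mult_right_mono) auto
    finally have B: "(1 - r\<^sup>2) * norm (z * (\<beta> / (1 - z))) \<le> 2 * norm \<beta>" .
    have "norm (z * (deriv L z + \<beta> / (1 - z))) \<le> norm (z * deriv L z) + norm (z * (\<beta> / (1 - z)))"
      unfolding distrib_left by (rule norm_triangle_ineq)
    then have "(1 - r\<^sup>2) * norm (z * (deriv L z + \<beta> / (1 - z))) \<le> (1 - r\<^sup>2) * (norm (z * deriv L z) + norm (z * (\<beta> / (1 - z))))"
      using r2 by (rule mult_left_mono)
    also have "\<dots> \<le> 2 * (2 + norm \<beta>)" using A B unfolding distrib_left by linarith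
    finally have "norm \<alpha> * ((1 - r\<^sup>2) * norm (z * (deriv L z + \<beta> / (1 - z)))) \<le> norm \<alpha> * (2 * (2 + norm \<beta>))"
      by (rule mult_left_mono) simp
    also have "\<dots> \<le> 1"
    proof -
      have "0 < 2 * (2 + norm \<beta>)" by (simp add: add_pos_nonneg)
      then show ?thesis using assms(2) by (simp only: pos_le_divide_eq)
    qed
    finally have "norm (k z) * (norm \<alpha> * ((1 - r\<^sup>2) * norm (z * (deriv L z + \<beta> / (1 - z))))) \<le> norm (k z) * 1"
      by (rule mult_left_mono) simp
    then show "(1 - (norm z)\<^sup>2) * norm (z * deriv (deriv f) z) \<le> norm (deriv f z)"
      by (simp add: df[OF z] ddf[OF z] norm_mult r_def mult_ac)
  qed
  moreover have "f 0 = 0" by (simp add: f_def C_transform_def)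
  moreover have "deriv f 0 = 1" by (simp add: df k_def C_integrand_def L_def[symmetric] L0)
  ultimately show ?thesis
    using f_holo unfolding f_def class_S_def class_A_def by blast
qed

end
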